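(* Let $\mu$ be a Borel measure on $\mathbb{R}$ with support contained in $[-1,1]$ and with $x^j\in L^1(\mu)$ for all $j\in\mathbb{N}_0$. Let $w=\{w_i\}_{i\in\mathbb{N}_0}$ be weights such that $\sum_{j}\frac{1}{w_j}|M_{j+k}|^2<\infty$ for all $k\in\mathbb{N}_0$, where $M_n=\int x^n\,\mathrm{d}\mu(x)$, let $F:\ell^2(w)\to L^2(\mu)$ be the closure of the operator sending a finitely supported sequence $c$ to the polynomial $\sum_ic_ix^i$, and let $F_w^*$ be its adjoint. Then the two operators $H=F_w^*F$ (in $\ell^2(w)$) and $K=FF_w^*$ (in $L^2(\mu)$) have the same spectrum, apart from the point $0$.
   Context: Weights satisfy $w_i>0$; $\ell^2(w)=\{c:\sum_iw_i|c_i|^2<\infty\}$ with inner product $\langle c|d\rangle_{\ell^2(w)}=\sum_iw_i\overline{c_i}d_i$. $F_w^*:L^2(\mu)\to\ell^2(w)$ denotes the Hilbert space adjoint of $F$ with respect to this inner product. *)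

theory Defs
  imports "HOL-Analysis.Analysis"
begin

section \<open>Complex inner product spaces given by a carrier\<close>

text \<open>The space L2(mu) depends on the term mu, so it cannot be a type of a type class; spaces are
  therefore records with an explicit carrier. Inner products are conjugate-linear in the first
  argument.\<close>

record 'a hspace =
  hcarrier :: "'a set"
  hadd :: "'a \<Rightarrow> 'a \<Rightarrow> 'a"
  hscale :: "complex \<Rightarrow> 'a \<Rightarrow> 'a"
  hinner :: "'a \<Rightarrow> 'a \<Rightarrow> complex"

definition hdiff :: "'a hspace \<Rightarrow> 'a \<Rightarrow> 'a \<Rightarrow> 'a" where
  "hdiff X x y = hadd X x (hscale X (- 1) y)"

definition hnorm :: "'a hspace \<Rightarrow> 'a \<Rightarrow> real" where
  "hnorm X x = sqrt (Re (hinner X x x))"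

section \<open>Unbounded operators\<close>

text \<open>An operator from X to Y, possibly defined only on a subspace of X, is identified with its
  graph, a subset of the product of the carriers. The product \<open>B A\<close> (first \<open>A\<close>, then \<open>B\<close>) on its
  natural domain \<open>{x \<in> dom A. A x \<in> dom B}\<close> is then the relational composition \<open>A O B\<close>.\<close>

text \<open>The closure of a (closable) operator is the operator whose graph is the closure of its graph.\<close>

definition graph_closure :: "'a hspace \<Rightarrow> 'b hspace \<Rightarrow> ('a \<times> 'b) set \<Rightarrow> ('a \<times> 'b) set" where
  "graph_closure X Y T =
     {(x, y). x \<in> hcarrier X \<and> y \<in> hcarrier Y \<and>
        (\<forall>e>0. \<exists>(x', y')\<in>T. hnorm X (hdiff X x x') < e \<and> hnorm Y (hdiff Y y y') < e)}"

definition hadjoint :: "'a hspace \<Rightarrow> 'b hspace \<Rightarrow> ('a \<times> 'b) set \<Rightarrow> ('b \<times> 'a) set" where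
  "hadjoint X Y T =
     {(y, z). y \<in> hcarrier Y \<and> z \<in> hcarrier X \<and>
        (\<forall>(x, v)\<in>T. hinner Y y v = hinner X z x)}"

definition shifted :: "'a hspace \<Rightarrow> ('a \<times> 'a) set \<Rightarrow> complex \<Rightarrow> ('a \<times> 'a) set" where
  "shifted X T l = {(x, hdiff X y (hscale X l x)) | x y. (x, y) \<in> T}"

text \<open>The number \<open>l\<close> is in the resolvent set if \<open>T - l\<close> is a bijection from the domain of \<open>T\<close> onto
  the whole space and its inverse is bounded.\<close>

definition resolvent_set :: "'a hspace \<Rightarrow> ('a \<times> 'a) set \<Rightarrow> complex set" where
  "resolvent_set X T =
     {l. (\<forall>y\<in>hcarrier X. \<exists>!x. (x, y) \<in> shifted X T l) \<and>
         (\<exists>C. \<forall>(x, y)\<in>shifted X T l. hnorm X x \<le> C * hnorm X y)}"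

definition op_spectrum :: "'a hspace \<Rightarrow> ('a \<times> 'a) set \<Rightarrow> complex set" where
  "op_spectrum X T = - resolvent_set X T"

section \<open>The weighted sequence space\<close>

definition ell2 :: "(nat \<Rightarrow> real) \<Rightarrow> (nat \<Rightarrow> complex) hspace" where
  "ell2 w =
     \<lparr> hcarrier = {c. summable (\<lambda>i. w i * (cmod (c i))\<^sup>2)},
       hadd = (\<lambda>c d i. c i + d i),
       hscale = (\<lambda>a c i. a * c i),
       hinner = (\<lambda>c d. \<Sum>i. of_real (w i) * cnj (c i) * d i) \<rparr>"

section \<open>The space L2 of a measure\<close>

definition sq_integrable :: "'a measure \<Rightarrow> ('a \<Rightarrow> complex) set" where
  "sq_integrable M = {f \<in> borel_measurable M. integrable M (\<lambda>x. (cmod (f x))\<^sup>2)}"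

definition ae_eq_rel :: "'a measure \<Rightarrow> (('a \<Rightarrow> complex) \<times> ('a \<Rightarrow> complex)) set" where
  "ae_eq_rel M = {(f, g). f \<in> sq_integrable M \<and> g \<in> sq_integrable M \<and> (AE x in M. f x = g x)}"

definition l2_class :: "'a measure \<Rightarrow> ('a \<Rightarrow> complex) \<Rightarrow> ('a \<Rightarrow> complex) set" where
  "l2_class M f = ae_eq_rel M `` {f}"

definition l2_rep :: "('a \<Rightarrow> complex) set \<Rightarrow> 'a \<Rightarrow> complex" where
  "l2_rep A = (SOME f. f \<in> A)"

definition L2 :: "'a measure \<Rightarrow> ('a \<Rightarrow> complex) set hspace" where
  "L2 M =
     \<lparr> hcarrier = sq_integrable M // ae_eq_rel M,
       hadd = (\<lambda>A B. l2_class M (\<lambda>x. l2_rep A x + l2_rep B x)),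
       hscale = (\<lambda>a A. l2_class M (\<lambda>x. a * l2_rep A x)),
       hinner = (\<lambda>A B. \<integral>x. cnj (l2_rep A x) * l2_rep B x \<partial>M) \<rparr>"

text \<open>The operations do not depend on the chosen representatives.\<close>

lemma equiv_ae_eq_rel: "equiv (sq_integrable M) (ae_eq_rel M)"
  by (rule equivI) (auto simp: ae_eq_rel_def refl_on_def sym_def trans_def elim: AE_mp)

lemma l2_rep_l2_class:
  assumes "f \<in> sq_integrable M"
  shows "l2_rep (l2_class M f) \<in> sq_integrable M" "AE x in M. l2_rep (l2_class M f) x = f x"
proof -
  have "f \<in> l2_class M f"
    using assms by (simp add: l2_class_def ae_eq_rel_def)
  then have "l2_rep (l2_class M f) \<in> l2_class M f"
    unfolding l2_rep_def by (rule someI[where P = "\<lambda>h. h \<in> l2_class M f"])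
  then show "l2_rep (l2_class M f) \<in> sq_integrable M" "AE x in M. l2_rep (l2_class M f) x = f x"
    by (auto simp: l2_class_def ae_eq_rel_def)
qed

lemma l2_class_cong:
  assumes "AE x in M. f x = g x" "f \<in> borel_measurable M" "g \<in> borel_measurable M"
  shows "l2_class M f = l2_class M g"
proof -
  have "integrable M (\<lambda>x. (cmod (f x))\<^sup>2) \<longleftrightarrow> integrable M (\<lambda>x. (cmod (g x))\<^sup>2)"
  proof (rule integrable_cong_AE)
    show "AE x in M. (cmod (f x))\<^sup>2 = (cmod (g x))\<^sup>2"
      using assms(1) by eventually_elim simp
  qed (use assms in measurable)
  then have "f \<in> sq_integrable M \<longleftrightarrow> g \<in> sq_integrable M"
    using assms by (simp add: sq_integrable_def)
  moreover have "(AE x in M. f x = h x) \<longleftrightarrow> (AE x in M. g x = h x)" for h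
  proof
    assume "AE x in M. f x = h x"
    with assms(1) show "AE x in M. g x = h x" by eventually_elim simp
  next
    assume "AE x in M. g x = h x"
    with assms(1) show "AE x in M. f x = h x" by eventually_elim simp
  qed
  ultimately show ?thesis
    by (auto simp: l2_class_def ae_eq_rel_def)
qed

lemma hadd_L2:
  assumes "f \<in> sq_integrable M" "g \<in> sq_integrable M"
  shows "hadd (L2 M) (l2_class M f) (l2_class M g) = l2_class M (\<lambda>x. f x + g x)"
proof -
  note r = l2_rep_l2_class[OF assms(1)] l2_rep_l2_class[OF assms(2)]
  have "AE x in M. l2_rep (l2_class M f) x + l2_rep (l2_class M g) x = f x + g x"
    using r(2) r(4) by eventually_elim simp
  then have "l2_class M (\<lambda>x. l2_rep (l2_class M f) x + l2_rep (l2_class M g) x)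
      = l2_class M (\<lambda>x. f x + g x)"
    by (rule l2_class_cong) (use r assms in \<open>auto simp: sq_integrable_def\<close>)
  then show ?thesis
    by (simp add: L2_def)
qed

lemma hscale_L2:
  assumes "f \<in> sq_integrable M"
  shows "hscale (L2 M) a (l2_class M f) = l2_class M (\<lambda>x. a * f x)"
proof -
  note r = l2_rep_l2_class[OF assms]
  have "AE x in M. a * l2_rep (l2_class M f) x = a * f x"
    using r(2) by eventually_elim simp
  then have "l2_class M (\<lambda>x. a * l2_rep (l2_class M f) x) = l2_class M (\<lambda>x. a * f x)"
    by (rule l2_class_cong) (use r assms in \<open>auto simp: sq_integrable_def\<close>)
  then show ?thesis
    by (simp add: L2_def)
qed

lemma hinner_L2:
  assumes "f \<in> sq_integrable M" "g \<in> sq_integrable M"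
  shows "hinner (L2 M) (l2_class M f) (l2_class M g) = (\<integral>x. cnj (f x) * g x \<partial>M)"
proof -
  note r = l2_rep_l2_class[OF assms(1)] l2_rep_l2_class[OF assms(2)]
  have "AE x in M. cnj (l2_rep (l2_class M f) x) * l2_rep (l2_class M g) x = cnj (f x) * g x"
    using r(2) r(4) by eventually_elim simp
  then have "(\<integral>x. cnj (l2_rep (l2_class M f) x) * l2_rep (l2_class M g) x \<partial>M)
      = (\<integral>x. cnj (f x) * g x \<partial>M)"
    by (intro integral_cong_AE borel_measurable_times
          measurable_compose[OF _ borel_measurable_continuous_onI[OF continuous_on_cnj]])
       (use r assms in \<open>auto simp: sq_integrable_def\<close>)
  then show ?thesis
    by (simp add: L2_def)
qed

section \<open>Moments and the operator from coefficients to polynomials\<close>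

definition measure_support :: "'a::topological_space measure \<Rightarrow> 'a set" where
  "measure_support M = {x. \<forall>U. open U \<and> x \<in> U \<longrightarrow> 0 < emeasure M U}"

definition moment :: "real measure \<Rightarrow> nat \<Rightarrow> real" where
  "moment M n = (\<integral>x. x ^ n \<partial>M)"

definition poly_op :: "real measure \<Rightarrow> ((nat \<Rightarrow> complex) \<times> (real \<Rightarrow> complex) set) set" where
  "poly_op M = {(c, l2_class M (\<lambda>x. \<Sum>i\<in>{i. c i \<noteq> 0}. c i * of_real x ^ i)) | c.
                  finite {i. c i \<noteq> 0}}"

end

theory Submission
  imports Defs
begin

text \<open>Write \<open>G\<close> for the adjoint of the closed operator \<open>F\<close> and \<open>H = F O G\<close>, \<open>K = G O F\<close> (first \<open>F\<close>,
  then \<open>G\<close>, and conversely). The orthogonal complement of the graph of \<open>F\<close> is the rotated graph of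
  \<open>G\<close>, so projecting \<open>(0, g)\<close> onto the graph of \<open>F\<close> gives \<open>g = F a + b\<close> with \<open>a = G b\<close>. If \<open>l \<noteq> 0\<close> is in
  the resolvent set of \<open>H\<close>, solve \<open>(H - l) x = a\<close> and put \<open>u = F x\<close>; then \<open>y = u + (u - b) / l\<close> solves
  \<open>(K - l) y = g\<close>, and the identity \<open>|u|\<^sup>2 = \<langle>H x, x\<rangle>\<close> bounds it. The roles of \<open>F\<close> and \<open>G\<close> can be
  exchanged.\<close>

section \<open>Spaces with a Hermitian inner product\<close>

text \<open>For bounded operators the inverse of \<open>K - l\<close> is
  \<open>(F (H - l)^-1 G - 1) / l\<close>. For unbounded ones this cannot be applied to an arbitrary
  \<open>g\<close>, which need not lie in the domain of \<open>G\<close>. The splitting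
  \<open>g = F a + b\<close> repairs that. On \<open>F a\<close> the inverse should act by
  intertwining as \<open>F (H - l)^-1\<close>, which gives \<open>u\<close>. The other part
  \<open>b\<close> does lie in the domain of \<open>G\<close>, and since \<open>G b = a\<close>, the
  formula gives \<open>(u - b) / l\<close>. So a single equation \<open>(H - l) x = a\<close> serves
  both parts, and their sum is \<open>y\<close>. This derivation is only heuristic; that
  \<open>y\<close> solves the equation is then checked directly on the graphs. For the exchanged
  roles the splitting comes from projecting \<open>(g, 0)\<close> instead of
  \<open>(0, g)\<close>.\<close>

locale hermitian_space =
  fixes X :: "'a hspace"
  assumes carrier_nonempty: "hcarrier X \<noteq> {}"
    and add_closed [simp]: "\<lbrakk>x \<in> hcarrier X; y \<in> hcarrier X\<rbrakk> \<Longrightarrow> hadd X x y \<in> hcarrier X"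
    and scale_closed [simp]: "x \<in> hcarrier X \<Longrightarrow> hscale X a x \<in> hcarrier X"
    and inner_add_right [simp]: "\<lbrakk>x \<in> hcarrier X; y \<in> hcarrier X; z \<in> hcarrier X\<rbrakk>
      \<Longrightarrow> hinner X x (hadd X y z) = hinner X x y + hinner X x z"
    and inner_scale_right [simp]: "\<lbrakk>x \<in> hcarrier X; y \<in> hcarrier X\<rbrakk>
      \<Longrightarrow> hinner X x (hscale X a y) = a * hinner X x y"
    and inner_commute: "\<lbrakk>x \<in> hcarrier X; y \<in> hcarrier X\<rbrakk> \<Longrightarrow> hinner X x y = cnj (hinner X y x)"
    and inner_self_nonneg: "x \<in> hcarrier X \<Longrightarrow> 0 \<le> Re (hinner X x x)"
    and inner_diff_self_eq_0: "\<lbrakk>x \<in> hcarrier X; y \<in> hcarrier X;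
      hinner X (hdiff X x y) (hdiff X x y) = 0\<rbrakk> \<Longrightarrow> x = y"
begin

lemma diff_closed [simp]: "\<lbrakk>x \<in> hcarrier X; y \<in> hcarrier X\<rbrakk> \<Longrightarrow> hdiff X x y \<in> hcarrier X"
  by (simp add: hdiff_def)

lemma inner_diff_right [simp]: "\<lbrakk>x \<in> hcarrier X; y \<in> hcarrier X; z \<in> hcarrier X\<rbrakk>
    \<Longrightarrow> hinner X x (hdiff X y z) = hinner X x y - hinner X x z"
  by (simp add: hdiff_def)

lemma inner_add_left [simp]: "\<lbrakk>x \<in> hcarrier X; y \<in> hcarrier X; z \<in> hcarrier X\<rbrakk>
    \<Longrightarrow> hinner X (hadd X y z) x = hinner X y x + hinner X z x"
  by (metis add_closed complex_cnj_add inner_add_right inner_commute)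

lemma inner_scale_left [simp]: "\<lbrakk>x \<in> hcarrier X; y \<in> hcarrier X\<rbrakk>
    \<Longrightarrow> hinner X (hscale X a y) x = cnj a * hinner X y x"
  by (metis scale_closed complex_cnj_mult inner_scale_right inner_commute)

lemma inner_diff_left [simp]: "\<lbrakk>x \<in> hcarrier X; y \<in> hcarrier X; z \<in> hcarrier X\<rbrakk>
    \<Longrightarrow> hinner X (hdiff X y z) x = hinner X y x - hinner X z x"
  by (simp add: hdiff_def)

text \<open>Definiteness applied to the difference, tested against itself. This takes the place of
  vector space axioms on the record: every identity between vectors is reduced to an identity
  between complex numbers, where \<open>algebra_simps\<close> applies.\<close>

lemma vec_eqI:
  assumes "x \<in> hcarrier X" "y \<in> hcarrier X"
    and "\<And>z. z \<in> hcarrier X \<Longrightarrow> hinner X z x = hinner X z y"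
  shows "x = y"
  using assms by (intro inner_diff_self_eq_0) (simp_all del: inner_diff_left)

lemma inner_self_real: "x \<in> hcarrier X \<Longrightarrow> hinner X x x = of_real (Re (hinner X x x))"
  by (metis Reals_cnj_iff inner_commute of_real_Re)

lemma norm_sq: "x \<in> hcarrier X \<Longrightarrow> (hnorm X x)\<^sup>2 = Re (hinner X x x)"
  by (simp add: hnorm_def inner_self_nonneg)

lemma inner_self: "x \<in> hcarrier X \<Longrightarrow> hinner X x x = of_real ((hnorm X x)\<^sup>2)"
  using inner_self_real norm_sq by simp

lemma norm_nonneg [simp]: "x \<in> hcarrier X \<Longrightarrow> 0 \<le> hnorm X x"
  by (simp add: hnorm_def inner_self_nonneg)

lemma norm_scale [simp]: "x \<in> hcarrier X \<Longrightarrow> hnorm X (hscale X a x) = cmod a * hnorm X x"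
proof -
  assume x: "x \<in> hcarrier X"
  have "cnj a * (a * hinner X x x) = of_real ((cmod a)\<^sup>2 * Re (hinner X x x))"
    using inner_self_real[OF x] complex_norm_square[of a]
    by (metis mult.assoc mult.commute of_real_mult)
  then have "hinner X (hscale X a x) (hscale X a x) = of_real ((cmod a)\<^sup>2 * Re (hinner X x x))"
    using x by (simp add: mult.left_commute)
  then show ?thesis
    by (simp add: hnorm_def real_sqrt_mult del: inner_scale_left inner_scale_right of_real_mult)
qed

lemma norm_diff_sq:
  assumes "x \<in> hcarrier X" "y \<in> hcarrier X"
  shows "(hnorm X (hdiff X x y))\<^sup>2 = (hnorm X x)\<^sup>2 + (hnorm X y)\<^sup>2 - 2 * Re (hinner X x y)"
proof -
  have "Re (hinner X y x) = Re (hinner X x y)"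
    using assms by (subst inner_commute) auto
  then show ?thesis
    using assms by (simp add: norm_sq)
qed

lemma Cauchy_Schwarz:
  assumes "x \<in> hcarrier X" "y \<in> hcarrier X"
  shows "cmod (hinner X x y) \<le> hnorm X x * hnorm X y"
proof -
  define c where "c = hinner X x y"
  define p where "p = (hnorm X x)\<^sup>2"
  define q where "q = (hnorm X y)\<^sup>2"
  have "0 \<le> (hnorm X (hdiff X (hscale X s y) (hscale X t x)))\<^sup>2" for s t
    by simp
  then have *: "0 \<le> (cmod s)\<^sup>2 * q + (cmod t)\<^sup>2 * p - 2 * Re (cnj s * (t * cnj c))" for s t
    using assms inner_commute[OF assms(2,1)]
    by (simp add: norm_diff_sq p_def q_def c_def power_mult_distrib algebra_simps)
  have cc: "0 \<le> p" "0 \<le> q"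
    by (simp_all add: p_def q_def)
  \<comment> \<open>The choice \<open>s = p\<close>, \<open>t = c\<close> settles the case
    \<open>p > 0\<close>, and the mirrored choice \<open>s = cnj c\<close>, \<open>t = q\<close> the
    case \<open>q > 0\<close>. If both vanish, \<open>s = 1\<close>, \<open>t = c\<close> forces
    \<open>c = 0\<close>.\<close>
  have "0 \<le> p * (p * q - (cmod c)\<^sup>2)"
    using *[of "of_real p" c] unfolding cmod_power2 by (simp add: algebra_simps power2_eq_square)
  moreover have "0 \<le> q * (p * q - (cmod c)\<^sup>2)"
    using *[of "cnj c" "of_real q"] unfolding cmod_power2 by (simp add: algebra_simps power2_eq_square)
  moreover have "0 \<le> - 2 * (cmod c)\<^sup>2" if "p = 0" "q = 0"
    using *[of 1 c] that unfolding cmod_power2 by (simp add: power2_eq_square)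
  ultimately have "(cmod c)\<^sup>2 \<le> p * q"
    using cc by (cases "p = 0"; cases "q = 0") (auto simp: zero_le_mult_iff mult_le_0_iff)
  then show ?thesis
    unfolding c_def p_def q_def by (metis assms norm_nonneg mult_nonneg_nonneg power2_le_imp_le power_mult_distrib)
qed

lemma norm_diff_le:
  assumes "x \<in> hcarrier X" "y \<in> hcarrier X"
  shows "hnorm X (hdiff X x y) \<le> hnorm X x + hnorm X y"
proof (rule power2_le_imp_le)
  have "- Re (hinner X x y) \<le> hnorm X x * hnorm X y"
    using Cauchy_Schwarz[OF assms] abs_Re_le_cmod[of "hinner X x y"] by linarith
  then show "(hnorm X (hdiff X x y))\<^sup>2 \<le> (hnorm X x + hnorm X y)\<^sup>2"
    using assms by (simp add: norm_diff_sq power2_sum)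
qed (use assms in simp)

lemma norm_add_le:
  assumes "x \<in> hcarrier X" "y \<in> hcarrier X"
  shows "hnorm X (hadd X x y) \<le> hnorm X x + hnorm X y"
proof -
  have "hadd X x y = hdiff X x (hscale X (- 1) y)"
    using assms by (intro vec_eqI) auto
  then show ?thesis
    using norm_diff_le[of x "hscale X (- 1) y"] assms by simp
qed

lemma norm_diff_triangle:
  assumes "x \<in> hcarrier X" "y \<in> hcarrier X" "z \<in> hcarrier X"
  shows "hnorm X (hdiff X x z) \<le> hnorm X (hdiff X x y) + hnorm X (hdiff X y z)"
proof -
  have "hdiff X x z = hadd X (hdiff X x y) (hdiff X y z)"
    using assms by (intro vec_eqI) auto
  then show ?thesis
    using norm_add_le[of "hdiff X x y" "hdiff X y z"] assms by simp
qed

text \<open>The record has no zero vector, so "norm zero implies zero" is used in this form.\<close>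

lemma norm_eq_0D:
  assumes "x \<in> hcarrier X" "hnorm X x = 0" "y \<in> hcarrier X"
  shows "hinner X y x = 0" "hinner X x y = 0"
  using Cauchy_Schwarz[of y x] Cauchy_Schwarz[of x y] assms by auto

section \<open>Subspaces, closures and orthogonality\<close>

definition subspace :: "'a set \<Rightarrow> bool" where
  "subspace T \<longleftrightarrow> T \<noteq> {} \<and> T \<subseteq> hcarrier X \<and>
     (\<forall>x\<in>T. \<forall>y\<in>T. hadd X x y \<in> T) \<and> (\<forall>x\<in>T. \<forall>a. hscale X a x \<in> T)"

definition hclosure :: "'a set \<Rightarrow> 'a set" where
  "hclosure T = {x \<in> hcarrier X. \<forall>e>0. \<exists>t\<in>T. hnorm X (hdiff X x t) < e}"

lemma subspace_closure:
  assumes T: "subspace T"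
  shows "subspace (hclosure T)"
proof -
  have C: "t \<in> hcarrier X" if "t \<in> T" for t
    using T that by (auto simp: subspace_def)
  have "hdiff X t t \<in> hcarrier X \<and> hnorm X (hdiff X t t) = 0" if "t \<in> T" for t
    using C[OF that] by (simp add: hnorm_def)
  then have "T \<subseteq> hclosure T"
    using C by (force simp: hclosure_def)
  then have "hclosure T \<noteq> {}"
    using T by (auto simp: subspace_def)
  moreover have "hadd X x y \<in> hclosure T" if "x \<in> hclosure T" "y \<in> hclosure T" for x y
  proof -
    have xy: "x \<in> hcarrier X" "y \<in> hcarrier X"
      using that by (auto simp: hclosure_def)
    have "\<exists>t\<in>T. hnorm X (hdiff X (hadd X x y) t) < e" if "e > 0" for e
    proof -
      have "e / 2 > 0"
        using \<open>e > 0\<close> by simp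
      then obtain t u where tu: "t \<in> T" "u \<in> T" "hnorm X (hdiff X x t) < e / 2" "hnorm X (hdiff X y u) < e / 2"
        using \<open>x \<in> hclosure T\<close> \<open>y \<in> hclosure T\<close> unfolding hclosure_def by blast
      have "hdiff X (hadd X x y) (hadd X t u) = hadd X (hdiff X x t) (hdiff X y u)"
        using xy C tu by (intro vec_eqI) auto
      then have "hnorm X (hdiff X (hadd X x y) (hadd X t u)) < e"
        using norm_add_le[of "hdiff X x t" "hdiff X y u"] xy C tu by fastforce
      then show ?thesis
        using tu T by (auto simp: subspace_def)
    qed
    then show ?thesis
      using xy by (simp add: hclosure_def)
  qed
  moreover have "hscale X a x \<in> hclosure T" if "x \<in> hclosure T" for a x
  proof -
    have x: "x \<in> hcarrier X"
      using that by (auto simp: hclosure_def)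
    have "\<exists>t\<in>T. hnorm X (hdiff X (hscale X a x) t) < e" if "e > 0" for e
    proof -
      \<comment> \<open>The summand 1 keeps the denominator positive when
        \<open>a = 0\<close>.\<close>
      have "e / (cmod a + 1) > 0"
        using \<open>e > 0\<close> by (simp add: add_nonneg_pos)
      then obtain t where t: "t \<in> T" "hnorm X (hdiff X x t) < e / (cmod a + 1)"
        using \<open>x \<in> hclosure T\<close> unfolding hclosure_def by blast
      have "hdiff X (hscale X a x) (hscale X a t) = hscale X a (hdiff X x t)"
        using x C t by (intro vec_eqI) (auto simp: algebra_simps)
      then have "hnorm X (hdiff X (hscale X a x) (hscale X a t)) = cmod a * hnorm X (hdiff X x t)"
        using x C t by simp
      also have "\<dots> \<le> (cmod a + 1) * hnorm X (hdiff X x t)"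
        using x C t by (intro mult_right_mono) auto
      also have "\<dots> < e"
        using t(2) by (simp add: pos_less_divide_eq add_nonneg_pos mult.commute)
      finally show ?thesis
        using t T by (auto simp: subspace_def)
    qed
    then show ?thesis
      using x by (simp add: hclosure_def)
  qed
  ultimately show ?thesis
    by (auto simp: subspace_def hclosure_def)
qed

text \<open>By Cauchy-Schwarz \<open>hinner X r\<close> is continuous, so its zeros on
  \<open>T\<close> persist on the closure. This lets the projection be tested against
  \<open>T\<close> alone and still yield orthogonality to the closed graph.\<close>

lemma orthogonal_closure:
  assumes "r \<in> hcarrier X" "T \<subseteq> hcarrier X" "\<And>t. t \<in> T \<Longrightarrow> hinner X r t = 0" "x \<in> hclosure T"
  shows "hinner X r x = 0"
proof (rule ccontr)
  assume ne: "hinner X r x \<noteq> 0"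
  have x: "x \<in> hcarrier X"
    using assms(4) by (auto simp: hclosure_def)
  define e where "e = cmod (hinner X r x) / (hnorm X r + 1)"
  have pos: "hnorm X r + 1 > 0"
    using norm_nonneg[OF assms(1)] by linarith
  then have "e > 0"
    using ne by (simp add: e_def)
  then obtain t where t: "t \<in> T" "hnorm X (hdiff X x t) < e"
    using assms(4) by (auto simp: hclosure_def)
  then have tX: "t \<in> hcarrier X"
    using assms(2) by auto
  have "cmod (hinner X r x) = cmod (hinner X r (hdiff X x t))"
    using assms(1,3) t x tX by simp
  also have "\<dots> \<le> hnorm X r * hnorm X (hdiff X x t)"
    using assms(1) x tX by (intro Cauchy_Schwarz) auto
  also have "\<dots> \<le> (hnorm X r + 1) * hnorm X (hdiff X x t)"
    using x tX by (intro mult_right_mono) auto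
  also have "\<dots> < (hnorm X r + 1) * e"
    using t pos by (intro mult_strict_left_mono) auto
  also have "\<dots> = cmod (hinner X r x)"
    using pos by (simp add: e_def)
  finally show False
    by simp
qed

end

section \<open>Completeness and orthogonal projection\<close>

locale hilbert_space = hermitian_space +
  assumes complete: "\<lbrakk>\<And>n::nat. s n \<in> hcarrier X;
      \<forall>e>0. \<exists>N. \<forall>m\<ge>N. \<forall>n\<ge>N. hnorm X (hdiff X (s m) (s n)) < e\<rbrakk>
    \<Longrightarrow> \<exists>x\<in>hcarrier X. (\<lambda>n. hnorm X (hdiff X (s n) x)) \<longlonglongrightarrow> 0"
begin

text \<open>A minimizing sequence for the distance from \<open>p\<close> is Cauchy, and its limit is
  the foot of the perpendicular. Since \<open>T\<close> itself may fail to be closed, the foot is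
  only claimed to lie in \<open>hclosure T\<close>.\<close>

lemma projection:
  assumes T: "subspace T" and p: "p \<in> hcarrier X"
  shows "\<exists>a\<in>hclosure T. \<forall>t\<in>T. hinner X (hdiff X p a) t = 0"
proof -
  have C: "t \<in> hcarrier X" if "t \<in> T" for t
    using T that by (auto simp: subspace_def)
  define d where "d = (INF t\<in>T. (hnorm X (hdiff X p t))\<^sup>2)"
  have T0: "T \<noteq> {}"
    using T by (simp add: subspace_def)
  have bdd: "bdd_below ((\<lambda>t. (hnorm X (hdiff X p t))\<^sup>2) ` T)"
    by (rule bdd_belowI2[of _ 0]) simp
  have d_le: "d \<le> (hnorm X (hdiff X p t))\<^sup>2" if "t \<in> T" for t
    unfolding d_def using that bdd by (rule cINF_lower[rotated])
  have "\<exists>t\<in>T. (hnorm X (hdiff X p t))\<^sup>2 < d + 1 / Suc n" for n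
    using cINF_less_iff[OF T0 bdd, of "d + 1 / Suc n"] by (simp add: d_def)
  then obtain s where s: "\<And>n. s n \<in> T" "\<And>n. (hnorm X (hdiff X p (s n)))\<^sup>2 < d + 1 / Suc n"
    by metis
  note sC = C[OF s(1)]
  have s_dist: "(hnorm X (hdiff X (s m) (s n)))\<^sup>2 < 2 / Suc m + 2 / Suc n" for m n
  proof -
    let ?h = "hscale X (1/2) (hadd X (s m) (s n))"
    have "?h \<in> T"
      using T s(1) by (auto simp: subspace_def)
    from d_le[OF this]
    have "4 * d \<le> 4 * (hnorm X (hdiff X p ?h))\<^sup>2"
      by simp
    \<comment> \<open>The parallelogram law for \<open>p - s m\<close> and \<open>p - s n\<close>,
      whose sum is twice \<open>p - ?h\<close>. The midpoint \<open>?h\<close> lies in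
      \<open>T\<close>, so its distance from \<open>p\<close> is at least the infimum.\<close>
    moreover have "(hnorm X (hdiff X (s m) (s n)))\<^sup>2 + 4 * (hnorm X (hdiff X p ?h))\<^sup>2
        = 2 * (hnorm X (hdiff X p (s m)))\<^sup>2 + 2 * (hnorm X (hdiff X p (s n)))\<^sup>2"
      using p sC by (simp add: norm_sq algebra_simps)
    ultimately show ?thesis
      using s(2)[of m] s(2)[of n] by linarith
  qed
  have "\<exists>N. \<forall>m\<ge>N. \<forall>n\<ge>N. hnorm X (hdiff X (s m) (s n)) < e" if "e > 0" for e
  proof -
    obtain N where N: "4 / Suc N < e\<^sup>2"
      using reals_Archimedean[of "e\<^sup>2 / 4"] \<open>e > 0\<close> by (auto simp: field_simps)
    have "hnorm X (hdiff X (s m) (s n)) < e" if "m \<ge> N" "n \<ge> N" for m n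
    proof (rule power2_less_imp_less)
      have "2 / real (Suc m) \<le> 2 / Suc N" "2 / real (Suc n) \<le> 2 / Suc N"
        using that by (auto intro!: divide_left_mono)
      then show "(hnorm X (hdiff X (s m) (s n)))\<^sup>2 < e\<^sup>2"
        using s_dist[of m n] N by linarith
    qed (use \<open>e > 0\<close> in simp)
    then show ?thesis
      by blast
  qed
  then obtain a where a: "a \<in> hcarrier X" and lim: "(\<lambda>n. hnorm X (hdiff X (s n) a)) \<longlonglongrightarrow> 0"
    using complete[of s] sC by blast
  have sym: "hnorm X (hdiff X a (s n)) = hnorm X (hdiff X (s n) a)" for n
    using a sC by (simp add: hnorm_def algebra_simps)
  have aT: "a \<in> hclosure T"
    unfolding hclosure_def
  proof (intro CollectI conjI a allI impI)
    fix e :: real assume "e > 0"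
    then have "\<forall>\<^sub>F n in sequentially. hnorm X (hdiff X (s n) a) < e"
      using order_tendstoD(2)[OF lim] by blast
    then obtain n where "hnorm X (hdiff X (s n) a) < e"
      by (auto simp: eventually_sequentially)
    then show "\<exists>t\<in>T. hnorm X (hdiff X a t) < e"
      using s(1)[of n] sym[of n] by (intro bexI[of _ "s n"]) simp_all
  qed
  define r where "r = hdiff X p a"
  have r: "r \<in> hcarrier X"
    using p a by (simp add: r_def)
  \<comment> \<open>Both sides are compared with \<open>sqrt d\<close>. The point
    \<open>a + u\<close> need not lie in \<open>T\<close>, so it is approximated by
    \<open>s n + u\<close>, which does; then \<open>p - (s n + u)\<close> differs from
    \<open>r - u\<close> by \<open>s n - a\<close>, whose norm tends to 0.\<close>
  have r_min: "(hnorm X r)\<^sup>2 \<le> (hnorm X (hdiff X r u))\<^sup>2" if "u \<in> T" for u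
  proof -
    have "(\<lambda>n. hnorm X (hdiff X p (s n)) + hnorm X (hdiff X (s n) a)) \<longlonglongrightarrow> sqrt d + 0"
    proof (intro tendsto_add lim)
      have "(\<lambda>n. (hnorm X (hdiff X p (s n)))\<^sup>2) \<longlonglongrightarrow> d"
      proof (rule tendsto_sandwich)
        show "\<forall>\<^sub>F n in sequentially. d \<le> (hnorm X (hdiff X p (s n)))\<^sup>2"
          using d_le s(1) by simp
        show "\<forall>\<^sub>F n in sequentially. (hnorm X (hdiff X p (s n)))\<^sup>2 \<le> d + inverse (real (Suc n))"
          using s(2) by (auto intro!: always_eventually less_imp_le simp: inverse_eq_divide)
        show "(\<lambda>n. d + inverse (real (Suc n))) \<longlonglongrightarrow> d"
          by (rule LIMSEQ_inverse_real_of_nat_add)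
      qed simp
      from tendsto_real_sqrt[OF this] show "(\<lambda>n. hnorm X (hdiff X p (s n))) \<longlonglongrightarrow> sqrt d"
        using p sC by simp
    qed
    then have "hnorm X r \<le> sqrt d + 0"
      by (rule LIMSEQ_le_const) (use norm_diff_triangle p sC a in \<open>auto simp: r_def\<close>)
    moreover have "sqrt d \<le> hnorm X (hdiff X r u)"
    proof (rule LIMSEQ_le_const[of "\<lambda>n. hnorm X (hdiff X r u) + hnorm X (hdiff X (s n) a)"
          "hnorm X (hdiff X r u) + 0", simplified add_0_right])
      have "sqrt d \<le> hnorm X (hdiff X r u) + hnorm X (hdiff X (s n) a)" for n
      proof -
        have "hadd X (s n) u \<in> T"
          using T s(1) that by (auto simp: subspace_def)
        then have "sqrt d \<le> hnorm X (hdiff X p (hadd X (s n) u))"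
          using d_le p C by (intro real_le_lsqrt) (auto)
        moreover have "hdiff X p (hadd X (s n) u) = hdiff X (hdiff X r u) (hdiff X (s n) a)"
          using p a sC C[OF that] by (intro vec_eqI) (auto simp: r_def)
        ultimately show ?thesis
          using norm_diff_le[of "hdiff X r u" "hdiff X (s n) a"] r sC a C[OF that] by simp
      qed
      then show "\<exists>N. \<forall>n\<ge>N. sqrt d \<le> hnorm X (hdiff X r u) + hnorm X (hdiff X (s n) a)"
        by blast
      show "(\<lambda>n. hnorm X (hdiff X r u) + hnorm X (hdiff X (s n) a)) \<longlonglongrightarrow> hnorm X (hdiff X r u)"
        using tendsto_add[OF tendsto_const lim] by simp
    qed
    ultimately show ?thesis
      using r by (intro power_mono) auto
  qed
  have "hinner X r t = 0" if t: "t \<in> T" for t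
  proof (cases "hnorm X t = 0")
    case True
    then show ?thesis
      using norm_eq_0D C t r by blast
  next
    case False
    \<comment> \<open>The multiple of \<open>t\<close> closest to \<open>r\<close>. With it,
      minimality of \<open>r\<close> reads \<open>2 A \<le> A\<close> for
      \<open>A = |<r, t>|^2 / |t|^2\<close>, so \<open>A\<close> vanishes.\<close>
    define c where "c = hinner X t r / of_real ((hnorm X t)\<^sup>2)"
    have "hscale X c t \<in> T"
      using T t by (simp add: subspace_def)
    then have "2 * Re (hinner X r (hscale X c t)) \<le> (hnorm X (hscale X c t))\<^sup>2"
      using r_min[of "hscale X c t"] norm_diff_sq[of r "hscale X c t"] r C by simp
    moreover have "Re (hinner X r (hscale X c t)) = (cmod (hinner X r t))\<^sup>2 / (hnorm X t)\<^sup>2"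
      using r C[OF t] inner_commute[OF C[OF t] r]
      unfolding cmod_power2 by (simp add: c_def power2_eq_square add_divide_distrib)
    moreover have "(hnorm X (hscale X c t))\<^sup>2 = (cmod (hinner X r t))\<^sup>2 / (hnorm X t)\<^sup>2"
      using False r C[OF t] inner_commute[OF C[OF t] r]
      by (simp add: c_def power_mult_distrib norm_divide power_divide power2_eq_square norm_mult)
    ultimately have "(cmod (hinner X r t))\<^sup>2 / (hnorm X t)\<^sup>2 \<le> 0"
      by simp
    then show ?thesis
      using False by (simp add: divide_le_0_iff)
  qed
  then show ?thesis
    using aT r_def by blast
qed

end

section \<open>Products and graphs\<close>

text \<open>The Hilbert sum of the two spaces. Graphs become subspaces of it, and orthogonal
  complements of graphs encode adjoints.\<close>

definition hprod :: "'a hspace \<Rightarrow> 'b hspace \<Rightarrow> ('a \<times> 'b) hspace" where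
  "hprod X Y =
     \<lparr> hcarrier = hcarrier X \<times> hcarrier Y,
       hadd = (\<lambda>p q. (hadd X (fst p) (fst q), hadd Y (snd p) (snd q))),
       hscale = (\<lambda>a p. (hscale X a (fst p), hscale Y a (snd p))),
       hinner = (\<lambda>p q. hinner X (fst p) (fst q) + hinner Y (snd p) (snd q)) \<rparr>"

lemma hprod_simps [simp]:
  "hcarrier (hprod X Y) = hcarrier X \<times> hcarrier Y"
  "hadd (hprod X Y) (x, y) (x', y') = (hadd X x x', hadd Y y y')"
  "hscale (hprod X Y) a (x, y) = (hscale X a x, hscale Y a y)"
  "hinner (hprod X Y) (x, y) (x', y') = hinner X x x' + hinner Y y y'"
  "hdiff (hprod X Y) (x, y) (x', y') = (hdiff X x x', hdiff Y y y')"
  by (simp_all add: hprod_def hdiff_def)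

lemma hermitian_space_hprod:
  assumes "hermitian_space X" "hermitian_space Y"
  shows "hermitian_space (hprod X Y)"
proof -
  interpret X: hermitian_space X by fact
  interpret Y: hermitian_space Y by fact
  show ?thesis
  proof
    show "hcarrier (hprod X Y) \<noteq> {}"
      using X.carrier_nonempty Y.carrier_nonempty by auto
    fix p q assume *: "p \<in> hcarrier (hprod X Y)" "q \<in> hcarrier (hprod X Y)"
      and 0: "hinner (hprod X Y) (hdiff (hprod X Y) p q) (hdiff (hprod X Y) p q) = 0"
    obtain x y x' y' where [simp]: "p = (x, y)" "q = (x', y')"
      by fastforce
    have xy: "x \<in> hcarrier X" "y \<in> hcarrier Y" "x' \<in> hcarrier X" "y' \<in> hcarrier Y"
      using * by auto
    define s t where "s = (hnorm X (hdiff X x x'))\<^sup>2" and "t = (hnorm Y (hdiff Y y y'))\<^sup>2"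
    have st: "hinner X (hdiff X x x') (hdiff X x x') = of_real s"
        "hinner Y (hdiff Y y y') (hdiff Y y y') = of_real t"
      using xy X.inner_self[of "hdiff X x x'"] Y.inner_self[of "hdiff Y y y'"]
      unfolding s_def t_def by (blast intro: X.diff_closed Y.diff_closed)+
    then have "of_real (s + t) = (0 :: complex)"
      using 0 by (simp del: X.inner_diff_left X.inner_diff_right Y.inner_diff_left Y.inner_diff_right)
    then have "s + t = 0"
      by (simp only: of_real_eq_0_iff)
    moreover have "s \<ge> 0" "t \<ge> 0"
      by (simp_all add: s_def t_def)
    ultimately have "s = 0" "t = 0"
      by linarith+
    then show "p = q"
      using st xy X.inner_diff_self_eq_0[of x x'] Y.inner_diff_self_eq_0[of y y']
      by (simp del: X.inner_diff_left X.inner_diff_right Y.inner_diff_left Y.inner_diff_right)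
  qed (auto simp: algebra_simps X.inner_self_nonneg Y.inner_self_nonneg
      intro: arg_cong2[where f = "(+)", OF X.inner_commute Y.inner_commute])
qed

lemma hnorm_hprod:
  assumes "hermitian_space X" "hermitian_space Y" "x \<in> hcarrier X" "y \<in> hcarrier Y"
  shows "hnorm (hprod X Y) (x, y) = sqrt ((hnorm X x)\<^sup>2 + (hnorm Y y)\<^sup>2)"
  using assms by (simp add: hnorm_def hermitian_space.inner_self_nonneg)

lemma hnorm_hprod_bounds:
  assumes "hermitian_space X" "hermitian_space Y" "x \<in> hcarrier X" "y \<in> hcarrier Y"
  shows "hnorm X x \<le> hnorm (hprod X Y) (x, y)" "hnorm Y y \<le> hnorm (hprod X Y) (x, y)"
    "hnorm (hprod X Y) (x, y) \<le> hnorm X x + hnorm Y y"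
  using hermitian_space.norm_nonneg[OF assms(1,3)] hermitian_space.norm_nonneg[OF assms(2,4)]
  by (simp_all add: hnorm_hprod[OF assms] real_sqrt_sum_squares_ge1 real_sqrt_sum_squares_ge2
      sqrt_sum_squares_le_sum)

lemma hilbert_space_hprod:
  assumes "hilbert_space X" "hilbert_space Y"
  shows "hilbert_space (hprod X Y)"
proof -
  interpret X: hilbert_space X by fact
  interpret Y: hilbert_space Y by fact
  interpret Z: hermitian_space "hprod X Y"
    by (rule hermitian_space_hprod) unfold_locales
  note bounds = hnorm_hprod_bounds[OF X.hermitian_space_axioms Y.hermitian_space_axioms]
  show ?thesis
  proof
    fix s :: "nat \<Rightarrow> _"
    assume s: "\<And>n. s n \<in> hcarrier (hprod X Y)"
      and Cauchy: "\<forall>e>0. \<exists>N. \<forall>m\<ge>N. \<forall>n\<ge>N. hnorm (hprod X Y) (hdiff (hprod X Y) (s m) (s n)) < e"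
    define f g where "f n = fst (s n)" and "g n = snd (s n)" for n
    have s_eq: "s n = (f n, g n)" for n
      by (simp add: f_def g_def)
    have C: "f n \<in> hcarrier X" "g n \<in> hcarrier Y" for n
      using s[of n] by (simp_all add: s_eq)
    have diffs: "hnorm X (hdiff X (f m) (f n)) \<le> hnorm (hprod X Y) (hdiff (hprod X Y) (s m) (s n))"
        "hnorm Y (hdiff Y (g m) (g n)) \<le> hnorm (hprod X Y) (hdiff (hprod X Y) (s m) (s n))" for m n
      using bounds(1,2)[OF X.diff_closed[OF C(1) C(1)] Y.diff_closed[OF C(2) C(2)]]
      by (simp_all add: s_eq)
    have "\<forall>e>0. \<exists>N. \<forall>m\<ge>N. \<forall>n\<ge>N. hnorm X (hdiff X (f m) (f n)) < e"
      using Cauchy diffs(1) by (meson le_less_trans)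
    then obtain x where x: "x \<in> hcarrier X" "(\<lambda>n. hnorm X (hdiff X (f n) x)) \<longlonglongrightarrow> 0"
      using X.complete C by blast
    have "\<forall>e>0. \<exists>N. \<forall>m\<ge>N. \<forall>n\<ge>N. hnorm Y (hdiff Y (g m) (g n)) < e"
      using Cauchy diffs(2) by (meson le_less_trans)
    then obtain y where y: "y \<in> hcarrier Y" "(\<lambda>n. hnorm Y (hdiff Y (g n) y)) \<longlonglongrightarrow> 0"
      using Y.complete C by blast
    have "(\<lambda>n. sqrt ((hnorm X (hdiff X (f n) x))\<^sup>2 + (hnorm Y (hdiff Y (g n) y))\<^sup>2)) \<longlonglongrightarrow> sqrt (0\<^sup>2 + 0\<^sup>2)"
      by (intro tendsto_intros x y)
    then have "(\<lambda>n. hnorm (hprod X Y) (hdiff (hprod X Y) (s n) (x, y))) \<longlonglongrightarrow> 0"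
      using C x y by (simp add: s_eq hnorm_hprod X.hermitian_space_axioms Y.hermitian_space_axioms)
    then show "\<exists>p\<in>hcarrier (hprod X Y). (\<lambda>n. hnorm (hprod X Y) (hdiff (hprod X Y) (s n) p)) \<longlonglongrightarrow> 0"
      using x y by (intro bexI[of _ "(x, y)"]) auto
  qed
qed

text \<open>\<open>graph_closure\<close> measures the two coordinates separately, the product norm
  jointly. The product norm lies between the maximum and the sum of the coordinate norms, hence the
  \<open>e / 2\<close> in one direction.\<close>

lemma hclosure_hprod:
  assumes "hermitian_space X" "hermitian_space Y" "T \<subseteq> hcarrier X \<times> hcarrier Y"
  shows "hermitian_space.hclosure (hprod X Y) T = graph_closure X Y T"
proof -
  interpret X: hermitian_space X by fact
  interpret Y: hermitian_space Y by fact
  interpret Z: hermitian_space "hprod X Y"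
    by (rule hermitian_space_hprod) unfold_locales
  note bounds = hnorm_hprod_bounds[OF assms(1,2)]
  have "(\<forall>e>0. \<exists>t\<in>T. hnorm (hprod X Y) (hdiff (hprod X Y) (x, y) t) < e) \<longleftrightarrow>
      (\<forall>e>0. \<exists>(x', y')\<in>T. hnorm X (hdiff X x x') < e \<and> hnorm Y (hdiff Y y y') < e)"
    (is "?L \<longleftrightarrow> ?R")
    if "x \<in> hcarrier X" "y \<in> hcarrier Y" for x y
  proof (intro iffI allI impI)
    fix e :: real assume ?L "e > 0"
    then obtain x' y' where t: "(x', y') \<in> T" "hnorm (hprod X Y) (hdiff X x x', hdiff Y y y') < e"
      by force
    then have "hdiff X x x' \<in> hcarrier X" "hdiff Y y y' \<in> hcarrier Y"
      using that assms(3) by auto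
    from bounds[OF this] t show "\<exists>(x', y')\<in>T. hnorm X (hdiff X x x') < e \<and> hnorm Y (hdiff Y y y') < e"
      by (intro bexI[of _ "(x', y')"]) auto
  next
    fix e :: real assume ?R "e > 0"
    then have "e / 2 > 0"
      by simp
    with \<open>?R\<close> obtain x' y' where t: "(x', y') \<in> T" "hnorm X (hdiff X x x') < e / 2" "hnorm Y (hdiff Y y y') < e / 2"
      by blast
    then have "hdiff X x x' \<in> hcarrier X" "hdiff Y y y' \<in> hcarrier Y"
      using that assms(3) by auto
    from bounds[OF this] t show "\<exists>t\<in>T. hnorm (hprod X Y) (hdiff (hprod X Y) (x, y) t) < e"
      by (intro bexI[of _ "(x', y')"]) auto
  qed
  then show ?thesis
    by (auto simp: Z.hclosure_def graph_closure_def)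
qed

section \<open>Products of a linear relation and its adjoint\<close>

text \<open>Isolates what the resolvent argument uses, in a form that can be instantiated both for
  \<open>(F, G)\<close> and for \<open>(G, F)\<close>. The duality is symmetric up to conjugation;
  \<open>split\<close> carries the closedness of the graph.\<close>

locale adjoint_pair = X: hermitian_space X + Y: hermitian_space Y
  for X :: "'a hspace" and Y :: "'b hspace" +
  fixes F :: "('a \<times> 'b) set" and G :: "('b \<times> 'a) set"
  assumes F: "F \<subseteq> hcarrier X \<times> hcarrier Y" and G: "G \<subseteq> hcarrier Y \<times> hcarrier X"
    and F_add: "\<lbrakk>(x, y) \<in> F; (x', y') \<in> F\<rbrakk> \<Longrightarrow> (hadd X x x', hadd Y y y') \<in> F"
    and F_scale: "(x, y) \<in> F \<Longrightarrow> (hscale X a x, hscale Y a y) \<in> F"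
    and G_add: "\<lbrakk>(y, x) \<in> G; (y', x') \<in> G\<rbrakk> \<Longrightarrow> (hadd Y y y', hadd X x x') \<in> G"
    and G_scale: "(y, x) \<in> G \<Longrightarrow> (hscale Y a y, hscale X a x) \<in> G"
    and adjoint: "\<lbrakk>(x, v) \<in> F; (y, z) \<in> G\<rbrakk> \<Longrightarrow> hinner Y y v = hinner X z x"
    and split: "g \<in> hcarrier Y \<Longrightarrow> \<exists>a v b. (a, v) \<in> F \<and> (b, a) \<in> G \<and> g = hadd Y v b"
begin

lemma F_carrier [simp]: "(x, y) \<in> F \<Longrightarrow> x \<in> hcarrier X" "(x, y) \<in> F \<Longrightarrow> y \<in> hcarrier Y"
  using F by auto

lemma G_carrier [simp]: "(y, x) \<in> G \<Longrightarrow> x \<in> hcarrier X" "(y, x) \<in> G \<Longrightarrow> y \<in> hcarrier Y"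
  using G by auto

lemma F_diff: "\<lbrakk>(x, y) \<in> F; (x', y') \<in> F\<rbrakk> \<Longrightarrow> (hdiff X x x', hdiff Y y y') \<in> F"
  by (simp add: hdiff_def F_add F_scale)

lemma G_diff: "\<lbrakk>(y, x) \<in> G; (y', x') \<in> G\<rbrakk> \<Longrightarrow> (hdiff Y y y', hdiff X x x') \<in> G"
  by (simp add: hdiff_def G_add G_scale)

lemma FG_shifted_iff: "(x, p) \<in> shifted X (F O G) l \<longleftrightarrow>
    (\<exists>u h. (x, u) \<in> F \<and> (u, h) \<in> G \<and> p = hdiff X h (hscale X l x))"
  by (auto simp: shifted_def)

lemma GF_shifted_iff: "(y, g) \<in> shifted Y (G O F) l \<longleftrightarrow>
    (\<exists>z k. (y, z) \<in> G \<and> (z, k) \<in> F \<and> g = hdiff Y k (hscale Y l y))"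
  by (auto simp: shifted_def)

text \<open>Let \<open>y\<close> be the difference of two solutions and \<open>z = G y\<close>, so
  \<open>F z = l y\<close>. Applying \<open>G\<close> gives \<open>H z = l z\<close>, and the
  resolvent bound for \<open>H\<close> makes \<open>z\<close> null. Then
  \<open>l <y, y> = <y, F z> = <z, z> = 0\<close>, and \<open>l\<close> is nonzero.\<close>

lemma resolvent_unique:
  assumes "l \<in> resolvent_set X (F O G)" "l \<noteq> 0"
    and "(y1, g) \<in> shifted Y (G O F) l" "(y2, g) \<in> shifted Y (G O F) l"
  shows "y1 = y2"
proof -
  obtain z1 k1 where 1: "(y1, z1) \<in> G" "(z1, k1) \<in> F" "g = hdiff Y k1 (hscale Y l y1)"
    using assms(3) by (auto simp: GF_shifted_iff)
  obtain z2 k2 where 2: "(y2, z2) \<in> G" "(z2, k2) \<in> F" "g = hdiff Y k2 (hscale Y l y2)"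
    using assms(4) by (auto simp: GF_shifted_iff)
  define y z k where "y = hdiff Y y1 y2" and "z = hdiff X z1 z2" and "k = hdiff Y k1 k2"
  have yz: "(y, z) \<in> G" and zk: "(z, k) \<in> F"
    using 1 2 by (auto simp: y_def z_def k_def G_diff F_diff)
  note C = F_carrier[OF zk] G_carrier[OF yz]
  have k: "k = hscale Y l y"
  proof (rule Y.vec_eqI)
    fix t assume t: "t \<in> hcarrier Y"
    have "hinner Y t k1 - l * hinner Y t y1 = hinner Y t g"
      using 1 t by simp
    moreover have "hinner Y t k2 - l * hinner Y t y2 = hinner Y t g"
      using 2(1,2) t by (subst 2(3)) simp
    ultimately show "hinner Y t k = hinner Y t (hscale Y l y)"
      using 1(1,2) 2(1,2) t by (simp add: k_def y_def algebra_simps)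
  qed (use C in auto)
  have "(k, hscale X l z) \<in> G"
    using k yz by (simp add: G_scale)
  then have "(z, hdiff X (hscale X l z) (hscale X l z)) \<in> shifted X (F O G) l"
    using zk by (auto simp: FG_shifted_iff)
  moreover have "hdiff X (hscale X l z) (hscale X l z) = hscale X 0 z"
    using C by (intro X.vec_eqI) auto
  ultimately have "(z, hscale X 0 z) \<in> shifted X (F O G) l"
    by simp
  then obtain D where "hnorm X z \<le> D * hnorm X (hscale X 0 z)"
    using assms(1) unfolding resolvent_set_def by blast
  then have "hnorm X z = 0"
    using C X.norm_nonneg[of z] by (simp del: X.norm_nonneg)
  then have "hinner Y y k = 0"
    using adjoint[OF zk yz] C X.norm_eq_0D(1)[of z z] by simp
  then have "hinner Y y y = 0"
    using k C assms(2) by simp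
  then show ?thesis
    using 1 2 Y.inner_diff_self_eq_0[of y1 y2] by (simp add: y_def)
qed

text \<open>The constant comes from the triangle inequality for \<open>y = u + (u - b) / l\<close>,
  with \<open>|b| \<le> |g|\<close> and \<open>|u| \<le> S |g|\<close>, where \<open>S\<close> is
  the square root of \<open>(1 + |l| C) C\<close>. Here \<open>C\<close> bounds \<open>x\<close> by
  \<open>a\<close>, and \<open>1 + |l| C\<close> bounds \<open>h = a + l x\<close> by
  \<open>a\<close>.\<close>

lemma resolvent_solution:
  assumes l: "l \<noteq> 0" and bound: "\<And>x p. (x, p) \<in> shifted X (F O G) l \<Longrightarrow> hnorm X x \<le> C * hnorm X p"
    and surj: "\<And>p. p \<in> hcarrier X \<Longrightarrow> \<exists>x. (x, p) \<in> shifted X (F O G) l"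
    and "0 \<le> C" and g: "g \<in> hcarrier Y"
  shows "\<exists>y. (y, g) \<in> shifted Y (G O F) l \<and>
    hnorm Y y \<le> (sqrt ((1 + cmod l * C) * C) + (sqrt ((1 + cmod l * C) * C) + 1) / cmod l) * hnorm Y g"
proof -
  obtain a v b where avb: "(a, v) \<in> F" "(b, a) \<in> G" and g_eq: "g = hadd Y v b"
    using split[OF g] by blast
  obtain x where "(x, a) \<in> shifted X (F O G) l"
    using surj avb by fastforce
  then obtain u h where uh: "(x, u) \<in> F" "(u, h) \<in> G" and a_eq: "a = hdiff X h (hscale X l x)"
    by (auto simp: FG_shifted_iff)
  note car = F_carrier[OF avb(1)] G_carrier[OF avb(2)] F_carrier[OF uh(1)] G_carrier[OF uh(2)]
  have h_eq: "h = hadd X a (hscale X l x)"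
    using car by (intro X.vec_eqI) (auto simp: a_eq)
  define y where "y = hadd Y u (hscale Y (1 / l) (hdiff Y u b))"
  define z where "z = hadd X h (hscale X (1 / l) (hdiff X h a))"
  have yC: "y \<in> hcarrier Y"
    using car by (simp add: y_def)
  have yz: "(y, z) \<in> G"
    unfolding y_def z_def by (intro G_add G_scale G_diff avb uh)
  \<comment> \<open>Since \<open>h - a = l x\<close>, the vector \<open>z = G y\<close> collapses to
    \<open>a + l x + x\<close>. All summands lie in the domain of \<open>F\<close>, although
    \<open>h\<close> alone was not known to. Hence \<open>F z = v + l u + u\<close>, and subtracting
    \<open>l y = l u + u - b\<close> leaves \<open>v + b = g\<close>.\<close>
  have "z = hadd X (hadd X a (hscale X l x)) x"
    using car l by (intro X.vec_eqI) (auto simp: z_def h_eq algebra_simps)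
  moreover have "(hadd X (hadd X a (hscale X l x)) x, hadd Y (hadd Y v (hscale Y l u)) u) \<in> F"
    by (intro F_add F_scale avb uh)
  ultimately have zk: "(z, hadd Y (hadd Y v (hscale Y l u)) u) \<in> F"
    by simp
  have "g = hdiff Y (hadd Y (hadd Y v (hscale Y l u)) u) (hscale Y l y)"
    using car l by (intro Y.vec_eqI) (auto simp: g_eq y_def algebra_simps)
  with yz zk have sol: "(y, g) \<in> shifted Y (G O F) l"
    by (auto simp: GF_shifted_iff)
  \<comment> \<open>The parts \<open>v\<close> and \<open>b\<close> are not orthogonal, but as
    \<open>v = F a\<close> and \<open>a = G b\<close> their inner product is \<open>|a|^2\<close>.
    Being nonnegative, this cross term lets \<open>g\<close> dominate \<open>a\<close> and
    \<open>b\<close> alike.\<close>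
  have "hinner Y b v = of_real ((hnorm X a)\<^sup>2)"
    using adjoint[OF avb] X.inner_self car by simp
  moreover from this have "hinner Y v b = of_real ((hnorm X a)\<^sup>2)"
    using Y.inner_commute[of v b] car by simp
  ultimately have g_sq: "(hnorm Y g)\<^sup>2 = (hnorm Y v)\<^sup>2 + (hnorm Y b)\<^sup>2 + 2 * (hnorm X a)\<^sup>2"
    using car by (simp add: Y.norm_sq g_eq del: of_real_power)
  have "(hnorm X a)\<^sup>2 \<le> (hnorm Y g)\<^sup>2" "(hnorm Y b)\<^sup>2 \<le> (hnorm Y g)\<^sup>2"
    unfolding g_sq using zero_le_power2[of "hnorm X a"] zero_le_power2[of "hnorm Y b"]
      zero_le_power2[of "hnorm Y v"] by linarith+
  then have a_le: "hnorm X a \<le> hnorm Y g" and b_le: "hnorm Y b \<le> hnorm Y g"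
    using g by (auto intro: power2_le_imp_le)
  have x_le: "hnorm X x \<le> C * hnorm X a"
    using bound \<open>(x, a) \<in> shifted X (F O G) l\<close> by blast
  have "hnorm X h \<le> hnorm X a + cmod l * hnorm X x"
    using X.norm_add_le[of a "hscale X l x"] car by (simp add: h_eq)
  also have "\<dots> \<le> hnorm X a + cmod l * (C * hnorm X a)"
    using x_le by (intro add_left_mono mult_left_mono) auto
  finally have h_le: "hnorm X h \<le> (1 + cmod l * C) * hnorm X a"
    by (simp add: algebra_simps)
  \<comment> \<open>\<open>F\<close> may be unbounded, so a bound on \<open>x\<close> says nothing
    about \<open>u = F x\<close>. Duality trades \<open>|u|^2\<close> for \<open><h, x>\<close>,
    where both factors are controlled by \<open>a\<close>.\<close>
  have "(hnorm Y u)\<^sup>2 = Re (hinner X h x)"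
    using adjoint[OF uh] Y.norm_sq car by simp
  also have "\<dots> \<le> hnorm X h * hnorm X x"
    using X.Cauchy_Schwarz[of h x] complex_Re_le_cmod[of "hinner X h x"] car by linarith
  also have "\<dots> \<le> ((1 + cmod l * C) * hnorm X a) * (C * hnorm X a)"
    using h_le x_le car \<open>0 \<le> C\<close> by (intro mult_mono) auto
  also have "\<dots> = ((1 + cmod l * C) * C) * (hnorm X a)\<^sup>2"
    by (simp add: power2_eq_square)
  finally have "hnorm Y u \<le> sqrt (((1 + cmod l * C) * C) * (hnorm X a)\<^sup>2)"
    using car by (intro real_le_rsqrt) auto
  also have "\<dots> = sqrt ((1 + cmod l * C) * C) * hnorm X a"
    using car by (simp add: real_sqrt_mult)
  also have "\<dots> \<le> sqrt ((1 + cmod l * C) * C) * hnorm Y g"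
    using a_le \<open>0 \<le> C\<close> by (intro mult_left_mono) auto
  finally have u_le: "hnorm Y u \<le> sqrt ((1 + cmod l * C) * C) * hnorm Y g" .
  have "hnorm Y y \<le> hnorm Y u + (1 / cmod l) * hnorm Y (hdiff Y u b)"
    using Y.norm_add_le[of u "hscale Y (1 / l) (hdiff Y u b)"] car by (simp add: y_def norm_divide)
  also have "\<dots> \<le> hnorm Y u + (1 / cmod l) * (hnorm Y u + hnorm Y b)"
    using Y.norm_diff_le[of u b] car by (intro add_left_mono mult_left_mono) auto
  also have "\<dots> \<le> sqrt ((1 + cmod l * C) * C) * hnorm Y g
      + (1 / cmod l) * (sqrt ((1 + cmod l * C) * C) * hnorm Y g + hnorm Y g)"
    using u_le b_le by (intro add_mono mult_left_mono) auto
  finally show ?thesis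
    using sol by (intro exI[of _ y]) (simp add: algebra_simps add_divide_distrib)
qed

lemma resolvent_subset: "resolvent_set X (F O G) - {0} \<subseteq> resolvent_set Y (G O F)"
proof
  fix l assume l: "l \<in> resolvent_set X (F O G) - {0}"
  obtain C0 where C0: "\<And>x p. (x, p) \<in> shifted X (F O G) l \<Longrightarrow> hnorm X x \<le> C0 * hnorm X p"
    using l unfolding resolvent_set_def by blast
  \<comment> \<open>The definition of \<open>resolvent_set\<close> admits a negative constant,
    whereas the estimates multiply inequalities by it and take square roots.\<close>
  define C where "C = max 0 C0"
  have C: "hnorm X x \<le> C * hnorm X p" if "(x, p) \<in> shifted X (F O G) l" for x p
  proof -
    have "p \<in> hcarrier X"
      using that by (auto simp: FG_shifted_iff)
    then have "C0 * hnorm X p \<le> C * hnorm X p"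
      by (intro mult_right_mono) (auto simp: C_def)
    then show ?thesis
      using C0[OF that] by linarith
  qed
  have surj: "\<exists>x. (x, p) \<in> shifted X (F O G) l" if "p \<in> hcarrier X" for p
    using l that unfolding resolvent_set_def by blast
  define D where "D = sqrt ((1 + cmod l * C) * C) + (sqrt ((1 + cmod l * C) * C) + 1) / cmod l"
  have sol: "\<exists>y. (y, g) \<in> shifted Y (G O F) l \<and> hnorm Y y \<le> D * hnorm Y g" if "g \<in> hcarrier Y" for g
    unfolding D_def using l C surj that by (intro resolvent_solution) (auto simp: C_def)
  have unique: "y1 = y2" if "(y1, g) \<in> shifted Y (G O F) l" "(y2, g) \<in> shifted Y (G O F) l" for y1 y2 g
    using resolvent_unique that l by blast
  \<comment> \<open>The bounded solution constructed above is the only one, so the bound holds on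
    the whole shifted graph.\<close>
  have "hnorm Y y \<le> D * hnorm Y g" if "(y, g) \<in> shifted Y (G O F) l" for y g
  proof -
    have "g \<in> hcarrier Y"
      using that by (auto simp: GF_shifted_iff)
    then show ?thesis
      using sol unique that by blast
  qed
  then show "l \<in> resolvent_set Y (G O F)"
    unfolding resolvent_set_def using sol unique by blast
qed

end

text \<open>One projection onto the graph of \<open>F\<close> supplies both splittings, and
  \<open>resolvent_subset\<close> for the two pairs gives the two inclusions between the resolvent
  sets away from 0.\<close>

theorem spectrum_adjoint_products:
  assumes "hilbert_space X" "hilbert_space Y"
    and T: "hermitian_space.subspace (hprod X Y) T"
    and F_def: "F = graph_closure X Y T" and G_def: "G = hadjoint X Y F"
  shows "op_spectrum X (F O G) - {0} = op_spectrum Y (G O F) - {0}"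
proof -
  interpret X: hilbert_space X by fact
  interpret Y: hilbert_space Y by fact
  interpret Z: hilbert_space "hprod X Y"
    by (rule hilbert_space_hprod) fact+
  have TZ: "T \<subseteq> hcarrier X \<times> hcarrier Y"
    using T by (simp add: Z.subspace_def)
  have F_eq: "F = Z.hclosure T"
    unfolding F_def using hclosure_hprod[OF X.hermitian_space_axioms Y.hermitian_space_axioms TZ] by simp
  have F: "Z.subspace F"
    unfolding F_eq using T by (rule Z.subspace_closure)
  then have FZ: "F \<subseteq> hcarrier X \<times> hcarrier Y"
    by (simp add: Z.subspace_def)
  have FC: "x \<in> hcarrier X" "y \<in> hcarrier Y" if "(x, y) \<in> F" for x y
    using FZ that by auto
  have F_add: "(hadd X x x', hadd Y y y') \<in> F" if "(x, y) \<in> F" "(x', y') \<in> F" for x y x' y'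
    using F that unfolding Z.subspace_def by fastforce
  have F_scale: "(hscale X a x, hscale Y a y) \<in> F" if "(x, y) \<in> F" for x y a
    using F that unfolding Z.subspace_def by fastforce
  have G_iff: "(y, z) \<in> G \<longleftrightarrow> y \<in> hcarrier Y \<and> z \<in> hcarrier X \<and>
      (\<forall>x v. (x, v) \<in> F \<longrightarrow> hinner Y y v = hinner X z x)" for y z
    by (auto simp: G_def hadjoint_def)
  have G_add: "(hadd Y y y', hadd X x x') \<in> G" if "(y, x) \<in> G" "(y', x') \<in> G" for x y x' y'
    using that FC by (auto simp: G_iff)
  have G_scale: "(hscale Y a y, hscale X a x) \<in> G" if "(y, x) \<in> G" for x y a
    using that FC by (auto simp: G_iff)
  \<comment> \<open>Project \<open>(p, q)\<close> onto the graph of \<open>F\<close>. The residual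
    \<open>(p - a, q - v)\<close> is orthogonal to the graph exactly when
    \<open>(q - v, a - p)\<close> belongs to \<open>G\<close>; the swap and the sign are the
    rotation of the graph.\<close>
  have split: "\<exists>a v b c. (a, v) \<in> F \<and> (b, c) \<in> G \<and> p = hdiff X a c \<and> q = hadd Y v b"
    if pq: "p \<in> hcarrier X" "q \<in> hcarrier Y" for p q
  proof -
    have "(p, q) \<in> hcarrier (hprod X Y)"
      using pq by simp
    then obtain a v where av: "(a, v) \<in> F"
      and orth: "\<And>t. t \<in> T \<Longrightarrow> hinner (hprod X Y) (hdiff X p a, hdiff Y q v) t = 0"
      using Z.projection[OF T] unfolding F_eq by (metis hprod_simps(5) surj_pair)
    note C = pq FC[OF av]
    have "hinner (hprod X Y) (hdiff X p a, hdiff Y q v) t = 0" if "t \<in> F" for t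
      using Z.orthogonal_closure[of "(hdiff X p a, hdiff Y q v)" T t] C TZ orth that
      by (simp add: F_eq)
    then have "hinner X (hdiff X p a) x + hinner Y (hdiff Y q v) y = 0" if "(x, y) \<in> F" for x y
      using that by fastforce
    then have "(hdiff Y q v, hdiff X a p) \<in> G"
      using C FC by (auto simp: G_iff algebra_simps add_eq_0_iff)
    moreover have "p = hdiff X a (hdiff X a p)" "q = hadd Y v (hdiff Y q v)"
      using C by (auto intro!: X.vec_eqI Y.vec_eqI)
    ultimately show ?thesis
      using av by blast
  qed
  \<comment> \<open>Any vector will do: \<open>hscale X 0 x0\<close> and
    \<open>hscale Y 0 y0\<close> stand for the zero vectors.\<close>
  obtain x0 where x0: "x0 \<in> hcarrier X"
    using X.carrier_nonempty by blast
  obtain y0 where y0: "y0 \<in> hcarrier Y"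
    using Y.carrier_nonempty by blast
  have GC: "x \<in> hcarrier X" "y \<in> hcarrier Y" if "(y, x) \<in> G" for x y
    using that by (simp_all add: G_iff)
  interpret FG: adjoint_pair X Y F G
  proof
    show "F \<subseteq> hcarrier X \<times> hcarrier Y" by (rule FZ)
    show "G \<subseteq> hcarrier Y \<times> hcarrier X" using GC by auto
    show "\<exists>a v b. (a, v) \<in> F \<and> (b, a) \<in> G \<and> g = hadd Y v b" if g: "g \<in> hcarrier Y" for g
    proof -
      obtain a v b c where *: "(a, v) \<in> F" "(b, c) \<in> G" "hscale X 0 x0 = hdiff X a c" "g = hadd Y v b"
        using split[of "hscale X 0 x0" g] x0 g by auto
      have "a = c"
        using FC[OF *(1)] GC[OF *(2)] x0
        by (intro X.inner_diff_self_eq_0) (simp_all add: *(3)[symmetric] del: X.inner_diff_left X.inner_diff_right)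
      then show ?thesis
        using * by blast
    qed
  qed (use F_add F_scale G_add G_scale in \<open>auto simp: G_iff\<close>)
  interpret GF: adjoint_pair Y X G F
  proof
    show "F \<subseteq> hcarrier X \<times> hcarrier Y" by (rule FZ)
    show "G \<subseteq> hcarrier Y \<times> hcarrier X" using GC by auto
    show "hinner X y v = hinner Y z x" if "(x, v) \<in> G" "(y, z) \<in> F" for x v y z
      using FG.adjoint[OF that(2,1)] FC[OF that(2)] GC[OF that(1)]
        X.inner_commute[of y v] Y.inner_commute[of z x] by simp
    show "\<exists>a v b. (a, v) \<in> G \<and> (b, a) \<in> F \<and> g = hadd X v b" if g: "g \<in> hcarrier X" for g
    proof -
      obtain a v b c where *: "(a, v) \<in> F" "(b, c) \<in> G" "g = hdiff X a c" "hscale Y 0 y0 = hadd Y v b"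
        using split[of g "hscale Y 0 y0"] y0 g by auto
      note C = FC[OF *(1)] GC[OF *(2)]
      \<comment> \<open>From \<open>0 = v + b\<close>, scaling \<open>(b, c)\<close> by -1 turns it
        into \<open>(v, - c)\<close> in \<open>G\<close>. Together with \<open>(a, v)\<close> in
        \<open>F\<close> and \<open>g = - c + a\<close> this is the splitting with exchanged
        roles.\<close>
      have "hscale Y (- 1) b = v"
      proof (rule Y.vec_eqI)
        fix t assume t: "t \<in> hcarrier Y"
        then have "hinner Y t (hscale Y 0 y0) = 0"
          using y0 by simp
        then show "hinner Y t (hscale Y (- 1) b) = hinner Y t v"
          using C t unfolding *(4) by (simp add: add_eq_0_iff)
      qed (use C in auto)
      moreover have "g = hadd X (hscale X (- 1) c) a"
        using C unfolding *(3) by (intro X.vec_eqI) auto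
      ultimately show ?thesis
        using G_scale[OF *(2), of "- 1"] *(1) by auto
    qed
  qed (use F_add F_scale G_add G_scale in auto)
  show ?thesis
    using FG.resolvent_subset GF.resolvent_subset by (auto simp: op_spectrum_def)
qed

section \<open>Completeness of the two function spaces\<close>

lemma sq_integrableD:
  "f \<in> sq_integrable M \<Longrightarrow> f \<in> borel_measurable M"
  "f \<in> sq_integrable M \<Longrightarrow> integrable M (\<lambda>x. (cmod (f x))\<^sup>2)"
  by (simp_all add: sq_integrable_def)

lemma sq_integrable_add:
  assumes "f \<in> sq_integrable M" "g \<in> sq_integrable M"
  shows "(\<lambda>x. f x + g x) \<in> sq_integrable M"
proof -
  note [measurable] = sq_integrableD(1)[OF assms(1)] sq_integrableD(1)[OF assms(2)]
  have le: "(cmod (a + b))\<^sup>2 \<le> 2 * (cmod a)\<^sup>2 + 2 * (cmod b)\<^sup>2" for a b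
  proof -
    have "(cmod (a + b))\<^sup>2 \<le> (cmod a + cmod b)\<^sup>2"
      by (intro power_mono norm_triangle_ineq) simp
    also have "\<dots> \<le> 2 * (cmod a)\<^sup>2 + 2 * (cmod b)\<^sup>2"
      using sum_squares_bound[of "cmod a" "cmod b"] by (simp add: power2_sum)
    finally show ?thesis .
  qed
  have "integrable M (\<lambda>x. (cmod (f x + g x))\<^sup>2)"
    by (rule Bochner_Integration.integrable_bound[of M "\<lambda>x. 2 * (cmod (f x))\<^sup>2 + 2 * (cmod (g x))\<^sup>2"])
      (use sq_integrableD(2)[OF assms(1)] sq_integrableD(2)[OF assms(2)] le in auto)
  then show ?thesis
    by (simp add: sq_integrable_def)
qed

lemma sq_integrable_scale:
  assumes "f \<in> sq_integrable M"
  shows "(\<lambda>x. a * f x) \<in> sq_integrable M"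
  using assms by (auto simp: sq_integrable_def norm_mult power_mult_distrib)

lemma sq_integrable_diff:
  assumes "f \<in> sq_integrable M" "g \<in> sq_integrable M"
  shows "(\<lambda>x. f x - g x) \<in> sq_integrable M"
  using sq_integrable_add[OF assms(1) sq_integrable_scale[OF assms(2), of "- 1"]] by simp

lemma sq_integrable_zero: "(\<lambda>x. 0) \<in> sq_integrable M"
  by (simp add: sq_integrable_def)

lemma sq_integrable_sum:
  "(\<And>i. i \<in> I \<Longrightarrow> f i \<in> sq_integrable M) \<Longrightarrow> (\<lambda>x. \<Sum>i\<in>I. f i x) \<in> sq_integrable M"
  by (induction I rule: infinite_finite_induct) (auto intro: sq_integrable_add sq_integrable_zero)

lemma integrable_cnj_mult:
  assumes "f \<in> sq_integrable M" "g \<in> sq_integrable M"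
  shows "integrable M (\<lambda>x. cnj (f x) * g x)"
proof -
  note [measurable] = sq_integrableD(1)[OF assms(1)] sq_integrableD(1)[OF assms(2)]
  have [measurable]: "(\<lambda>x. cnj (f x)) \<in> borel_measurable M"
    by (rule measurable_compose[OF _ borel_measurable_continuous_onI[OF continuous_on_cnj]]) simp_all
  have le: "cmod a * cmod b \<le> (cmod a)\<^sup>2 + (cmod b)\<^sup>2" for a b
  proof -
    have "2 * (cmod a * cmod b) \<le> (cmod a)\<^sup>2 + (cmod b)\<^sup>2"
      using sum_squares_bound[of "cmod a" "cmod b"] by (simp add: mult.assoc)
    moreover have "0 \<le> cmod a * cmod b"
      by simp
    ultimately show ?thesis
      by linarith
  qed
  show ?thesis
    by (rule Bochner_Integration.integrable_bound[of M "\<lambda>x. (cmod (f x))\<^sup>2 + (cmod (g x))\<^sup>2"])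
      (use sq_integrableD(2)[OF assms(1)] sq_integrableD(2)[OF assms(2)] le in \<open>auto simp: norm_mult\<close>)
qed

lemma integral_cnj_mult_add:
  assumes "f \<in> sq_integrable M" "g \<in> sq_integrable M" "h \<in> sq_integrable M"
  shows "(\<integral>x. cnj (f x) * (g x + h x) \<partial>M) = (\<integral>x. cnj (f x) * g x \<partial>M) + (\<integral>x. cnj (f x) * h x \<partial>M)"
  using assms by (simp add: distrib_left integrable_cnj_mult)

lemma integral_cnj_mult_scale:
  "(\<integral>x. cnj (f x) * (a * g x) \<partial>M) = a * (\<integral>x. cnj (f x) * g x \<partial>M)"
  by (simp add: mult.left_commute)

lemma integral_cnj_mult_commute:
  "(\<integral>x. cnj (f x) * g x \<partial>M) = cnj (\<integral>x. cnj (g x) * f x \<partial>M)"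
  using Bochner_Integration.integral_cnj[of M "\<lambda>x. cnj (g x) * f x"] by (simp add: mult.commute)

lemma integral_cnj_mult_self:
  "(\<integral>x. cnj (f x) * f x \<partial>M) = of_real (\<integral>x. (cmod (f x))\<^sup>2 \<partial>M)"
  by (simp only: mult.commute[of "cnj _"] complex_norm_square[symmetric] integral_complex_of_real)

text \<open>Riesz--Fischer. Along a subsequence whose differences \<open>d k\<close> satisfy
  \<open>\<integral>|d k|\<^sup>2 \<le> 8\<^sup>-\<^sup>k\<close>, the sum of \<open>2\<^sup>k |d k|\<^sup>2\<close> has finite integral; hence \<open>d k\<close> decays geometrically
  almost everywhere and the subsequence converges pointwise. Fatou's lemma does the rest.\<close>

lemma sq_integrable_complete:
  assumes f: "\<And>n::nat. f n \<in> sq_integrable M"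
    and Cauchy: "\<And>e. e > 0 \<Longrightarrow> \<exists>N. \<forall>m\<ge>N. \<forall>n\<ge>N. (\<integral>x. (cmod (f m x - f n x))\<^sup>2 \<partial>M) < e"
  shows "\<exists>g\<in>sq_integrable M. (\<lambda>n. \<integral>x. (cmod (f n x - g x))\<^sup>2 \<partial>M) \<longlonglongrightarrow> 0"
proof -
  note [measurable] = sq_integrableD(1)[OF f]
  have nn_int: "(\<integral>\<^sup>+x. (cmod (f m x - f n x))\<^sup>2 \<partial>M) = ennreal (\<integral>x. (cmod (f m x - f n x))\<^sup>2 \<partial>M)" for m n
    by (intro nn_integral_eq_integral sq_integrableD(2) sq_integrable_diff f) auto
  have "\<exists>N. \<forall>m\<ge>N. \<forall>n\<ge>N. (\<integral>x. (cmod (f m x - f n x))\<^sup>2 \<partial>M) < (1 / 8) ^ k" for k :: nat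
    by (rule Cauchy) simp
  then obtain N where N: "\<And>k m n. m \<ge> N k \<Longrightarrow> n \<ge> N k \<Longrightarrow> (\<integral>x. (cmod (f m x - f n x))\<^sup>2 \<partial>M) < (1 / 8) ^ k"
    by metis
  \<comment> \<open>An explicit index that dominates both \<open>k\<close> and \<open>N k\<close>.
    As the partial sums increase, \<open>r (Suc k)\<close> dominates \<open>N k\<close> too, so
    consecutive terms differ by less than \<open>(1 / 8) ^ k\<close> in squared norm.\<close>
  define r where "r k = k + (\<Sum>i\<le>k. N i)" for k
  have "N k \<le> (\<Sum>i\<le>k. N i)" for k
    by (rule member_le_sum) auto
  then have r_ge: "k \<le> r k" "N k \<le> r k" "N k \<le> r (Suc k)" for k
    by (auto simp: r_def intro: trans_le_add1 trans_le_add2 le_SucI)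
  define d where "d k x = f (r (Suc k)) x - f (r k) x" for k x
  have [measurable]: "d k \<in> borel_measurable M" for k
    unfolding d_def by measurable
  have "(\<integral>\<^sup>+x. (\<Sum>k. ennreal (2 ^ k * (cmod (d k x))\<^sup>2)) \<partial>M) = (\<Sum>k. \<integral>\<^sup>+x. ennreal (2 ^ k * (cmod (d k x))\<^sup>2) \<partial>M)"
    by (rule nn_integral_suminf) measurable
  also have "\<dots> \<le> (\<Sum>k. ennreal ((1 / 4) ^ k))"
  proof (rule suminf_le)
    fix k
    have "(\<integral>\<^sup>+x. ennreal (2 ^ k * (cmod (d k x))\<^sup>2) \<partial>M) = ennreal (2 ^ k) * (\<integral>\<^sup>+x. ennreal ((cmod (d k x))\<^sup>2) \<partial>M)"
      by (simp add: ennreal_mult' nn_integral_cmult)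
    also have "\<dots> \<le> ennreal (2 ^ k) * ennreal ((1 / 8) ^ k)"
      unfolding d_def nn_int by (intro mult_left_mono ennreal_leI less_imp_le N r_ge) simp
    also have "\<dots> = ennreal ((1 / 4) ^ k)"
      by (simp add: ennreal_mult'[symmetric] power_mult_distrib[symmetric])
    finally show "(\<integral>\<^sup>+x. ennreal (2 ^ k * (cmod (d k x))\<^sup>2) \<partial>M) \<le> ennreal ((1 / 4) ^ k)" .
  qed auto
  also have "\<dots> < \<infinity>"
    by (subst suminf_ennreal2) (auto simp: summable_geometric)
  finally have "AE x in M. (\<Sum>k. ennreal (2 ^ k * (cmod (d k x))\<^sup>2)) \<noteq> \<infinity>"
    by (intro nn_integral_PInf_AE) auto
  moreover have "convergent (\<lambda>k. f (r k) x)" if "(\<Sum>k. ennreal (2 ^ k * (cmod (d k x))\<^sup>2)) \<noteq> \<infinity>" for x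
  proof -
    have "summable (\<lambda>k. 2 ^ k * (cmod (d k x))\<^sup>2)"
      using that by (intro summable_suminf_not_top) auto
    then have "(\<lambda>k. 2 ^ k * (cmod (d k x))\<^sup>2) \<longlonglongrightarrow> 0"
      by (rule summable_LIMSEQ_zero)
    then have "\<forall>\<^sub>F k in sequentially. 2 ^ k * (cmod (d k x))\<^sup>2 < 1"
      by (rule order_tendstoD(2)) simp
    then have "\<forall>\<^sub>F k in sequentially. cmod (d k x) \<le> sqrt (1 / 2) ^ k"
    proof eventually_elim
      case (elim k)
      then have "(cmod (d k x))\<^sup>2 \<le> (1 / 2) ^ k"
        by (simp add: field_simps power_one_over)
      then have "cmod (d k x) \<le> sqrt ((1 / 2) ^ k)"
        by (rule real_le_rsqrt)
      then show ?case
        by (simp add: real_sqrt_power)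
    qed
    moreover have "sqrt (1 / 2) < 1"
      by (simp add: real_sqrt_lt_1_iff)
    then have "summable (\<lambda>k. sqrt (1 / 2) ^ k)"
      by (intro summable_geometric) simp
    ultimately have "summable (\<lambda>k. d k x)"
      by (rule summable_comparison_test_ev)
    then have "convergent (\<lambda>k. f (r 0) x + (\<Sum>i<k. d i x))"
      by (intro convergent_add convergent_const) (simp add: summable_iff_convergent)
    moreover have "f (r 0) x + (\<Sum>i<k. d i x) = f (r k) x" for k
      using sum_lessThan_telescope[of "\<lambda>k. f (r k) x" k] by (simp add: d_def)
    ultimately show ?thesis
      by simp
  qed
  ultimately have conv: "AE x in M. convergent (\<lambda>k. f (r k) x)"
    by auto
  \<comment> \<open>Off the set of convergence \<open>lim\<close> takes an unspecified value; this
    concerns only a null set and leaves \<open>g\<close> measurable.\<close>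
  define g where "g x = lim (\<lambda>k. f (r k) x)" for x
  have [measurable]: "g \<in> borel_measurable M"
    unfolding g_def by measurable
  \<comment> \<open>Stated with the nonnegative integral because integrability of
    \<open>|f n - g|^2\<close> is not yet known; it is a consequence of this bound.\<close>
  have Fatou: "(\<integral>\<^sup>+x. (cmod (f n x - g x))\<^sup>2 \<partial>M) \<le> ennreal e"
    if e: "\<And>m. m \<ge> L \<Longrightarrow> (\<integral>x. (cmod (f n x - f m x))\<^sup>2 \<partial>M) < e" for n L e
  proof -
    have "(\<integral>\<^sup>+x. (cmod (f n x - g x))\<^sup>2 \<partial>M)
        = (\<integral>\<^sup>+x. liminf (\<lambda>k. ennreal ((cmod (f n x - f (r k) x))\<^sup>2)) \<partial>M)"
    proof (rule nn_integral_cong_AE, use conv in eventually_elim)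
      case (elim x)
      then have "(\<lambda>k. f (r k) x) \<longlonglongrightarrow> g x"
        by (simp add: g_def convergent_LIMSEQ_iff)
      then have "(\<lambda>k. ennreal ((cmod (f n x - f (r k) x))\<^sup>2)) \<longlonglongrightarrow> ennreal ((cmod (f n x - g x))\<^sup>2)"
        by (intro tendsto_intros)
      from lim_imp_Liminf[OF _ this] show ?case
        by simp
    qed
    also have "\<dots> \<le> liminf (\<lambda>k. \<integral>\<^sup>+x. ennreal ((cmod (f n x - f (r k) x))\<^sup>2) \<partial>M)"
      by (rule nn_integral_liminf) measurable
    also have "\<dots> \<le> ennreal e"
    proof (rule Liminf_le)
      have "(\<integral>\<^sup>+x. ennreal ((cmod (f n x - f (r k) x))\<^sup>2) \<partial>M) \<le> ennreal e" if "k \<ge> L" for k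
        unfolding nn_int using that r_ge(1)[of k] by (intro ennreal_leI less_imp_le[OF e]) simp
      then show "\<forall>\<^sub>F k in sequentially. (\<integral>\<^sup>+x. ennreal ((cmod (f n x - f (r k) x))\<^sup>2) \<partial>M) \<le> ennreal e"
        by (auto simp: eventually_sequentially)
    qed simp
    finally show ?thesis .
  qed
  have diff: "(\<lambda>x. f n x - g x) \<in> sq_integrable M"
    if "\<And>m. m \<ge> L \<Longrightarrow> (\<integral>x. (cmod (f n x - f m x))\<^sup>2 \<partial>M) < e" for n L e
  proof -
    have "(\<integral>\<^sup>+x. (cmod (f n x - g x))\<^sup>2 \<partial>M) \<le> ennreal e"
      using that by (rule Fatou)
    then have "(\<integral>\<^sup>+x. ennreal (norm ((cmod (f n x - g x))\<^sup>2)) \<partial>M) < \<infinity>"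
      using le_less_trans[OF _ ennreal_less_top] by simp
    then show ?thesis
      by (simp add: sq_integrable_def integrableI_bounded)
  qed
  \<comment> \<open>A single difference \<open>f L0 - g\<close> in the space is enough to put
    \<open>g\<close> there.\<close>
  obtain L0 where "\<forall>m\<ge>L0. \<forall>n\<ge>L0. (\<integral>x. (cmod (f m x - f n x))\<^sup>2 \<partial>M) < 1"
    using Cauchy[of 1] by auto
  then have "(\<lambda>x. f L0 x - g x) \<in> sq_integrable M"
    by (intro diff[of L0 L0 1]) simp
  from sq_integrable_diff[OF f[of L0] this] have g: "g \<in> sq_integrable M"
    by simp
  moreover have "(\<lambda>n. \<integral>x. (cmod (f n x - g x))\<^sup>2 \<partial>M) \<longlonglongrightarrow> 0"
  proof (rule LIMSEQ_I)
    fix e :: real assume "e > 0"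
    then obtain L where L: "\<forall>m\<ge>L. \<forall>n\<ge>L. (\<integral>x. (cmod (f m x - f n x))\<^sup>2 \<partial>M) < e / 2"
      using Cauchy[of "e / 2"] by auto
    have "norm ((\<integral>x. (cmod (f n x - g x))\<^sup>2 \<partial>M) - 0) < e" if "n \<ge> L" for n
    proof -
      have "(\<integral>\<^sup>+x. (cmod (f n x - g x))\<^sup>2 \<partial>M) \<le> ennreal (e / 2)"
        using L that by (intro Fatou[of L]) auto
      moreover have "(\<integral>\<^sup>+x. (cmod (f n x - g x))\<^sup>2 \<partial>M) = ennreal (\<integral>x. (cmod (f n x - g x))\<^sup>2 \<partial>M)"
        by (intro nn_integral_eq_integral sq_integrableD(2) sq_integrable_diff f g) auto
      ultimately have "(\<integral>x. (cmod (f n x - g x))\<^sup>2 \<partial>M) \<le> e / 2"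
        using \<open>e > 0\<close> by simp
      moreover have "0 \<le> (\<integral>x. (cmod (f n x - g x))\<^sup>2 \<partial>M)"
        by simp
      ultimately show ?thesis
        using \<open>e > 0\<close> by simp
    qed
    then show "\<exists>no. \<forall>n\<ge>no. norm ((\<integral>x. (cmod (f n x - g x))\<^sup>2 \<partial>M) - 0) < e"
      by blast
  qed
  ultimately show ?thesis
    by blast
qed

section \<open>The space of square integrable classes as a Hilbert space\<close>

lemma L2_carrier: "hcarrier (L2 M) = l2_class M ` sq_integrable M"
  by (auto simp: L2_def quotient_def l2_class_def)

lemma hdiff_L2:
  assumes "f \<in> sq_integrable M" "g \<in> sq_integrable M"
  shows "hdiff (L2 M) (l2_class M f) (l2_class M g) = l2_class M (\<lambda>x. f x - g x)"
  using assms hadd_L2[OF assms(1) sq_integrable_scale[OF assms(2), of "- 1"]]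
  by (simp add: hdiff_def hscale_L2)

lemma hnorm_L2:
  assumes "f \<in> sq_integrable M"
  shows "hnorm (L2 M) (l2_class M f) = sqrt (\<integral>x. (cmod (f x))\<^sup>2 \<partial>M)"
  using assms by (simp add: hnorm_def hinner_L2 integral_cnj_mult_self)

lemma hilbert_space_L2: "hilbert_space (L2 M)"
proof
  show "hcarrier (L2 M) \<noteq> {}"
    using sq_integrable_zero by (auto simp: L2_carrier)
next
  fix A B assume "A \<in> hcarrier (L2 M)" "B \<in> hcarrier (L2 M)"
  then show "hadd (L2 M) A B \<in> hcarrier (L2 M)"
    by (auto simp: L2_carrier hadd_L2 sq_integrable_add)
next
  fix A a assume "A \<in> hcarrier (L2 M)"
  then show "hscale (L2 M) a A \<in> hcarrier (L2 M)"
    by (auto simp: L2_carrier hscale_L2 sq_integrable_scale)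
next
  fix A B C assume "A \<in> hcarrier (L2 M)" "B \<in> hcarrier (L2 M)" "C \<in> hcarrier (L2 M)"
  then show "hinner (L2 M) A (hadd (L2 M) B C) = hinner (L2 M) A B + hinner (L2 M) A C"
    by (auto simp: L2_carrier hadd_L2 hinner_L2 sq_integrable_add integral_cnj_mult_add)
next
  fix A B a assume "A \<in> hcarrier (L2 M)" "B \<in> hcarrier (L2 M)"
  then show "hinner (L2 M) A (hscale (L2 M) a B) = a * hinner (L2 M) A B"
    by (auto simp: L2_carrier hscale_L2 hinner_L2 sq_integrable_scale integral_cnj_mult_scale)
next
  fix A B assume "A \<in> hcarrier (L2 M)" "B \<in> hcarrier (L2 M)"
  then show "hinner (L2 M) A B = cnj (hinner (L2 M) B A)"
    by (auto simp: L2_carrier hinner_L2 intro: integral_cnj_mult_commute)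
next
  fix A assume "A \<in> hcarrier (L2 M)"
  then show "0 \<le> Re (hinner (L2 M) A A)"
    by (auto simp: L2_carrier hinner_L2 integral_cnj_mult_self)
next
  fix A B assume "A \<in> hcarrier (L2 M)" "B \<in> hcarrier (L2 M)"
    and 0: "hinner (L2 M) (hdiff (L2 M) A B) (hdiff (L2 M) A B) = 0"
  then obtain f g where fg: "f \<in> sq_integrable M" "g \<in> sq_integrable M"
    and [simp]: "A = l2_class M f" "B = l2_class M g"
    by (auto simp: L2_carrier)
  have "(\<integral>x. (cmod (f x - g x))\<^sup>2 \<partial>M) = 0"
    using 0 fg integral_cnj_mult_self[of M "\<lambda>x. f x - g x"]
    by (simp add: hdiff_L2 hinner_L2 sq_integrable_diff)
  then have "AE x in M. (cmod (f x - g x))\<^sup>2 = 0"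
    using sq_integrableD(2)[OF sq_integrable_diff[OF fg]] by (simp add: integral_nonneg_eq_0_iff_AE)
  then have "AE x in M. f x = g x"
    by simp
  then show "A = B"
    using fg by (simp add: l2_class_cong sq_integrableD)
next
  fix s :: "nat \<Rightarrow> _"
  assume s: "\<And>n. s n \<in> hcarrier (L2 M)"
    and Cauchy: "\<forall>e>0. \<exists>N. \<forall>m\<ge>N. \<forall>n\<ge>N. hnorm (L2 M) (hdiff (L2 M) (s m) (s n)) < e"
  have "\<forall>n. \<exists>f. f \<in> sq_integrable M \<and> s n = l2_class M f"
    using s by (auto simp: L2_carrier)
  then obtain f where f: "\<And>n. f n \<in> sq_integrable M" and s_eq: "\<And>n. s n = l2_class M (f n)"
    by metis
  have "\<exists>N. \<forall>m\<ge>N. \<forall>n\<ge>N. (\<integral>x. (cmod (f m x - f n x))\<^sup>2 \<partial>M) < e" if "e > 0" for e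
    using Cauchy[rule_format, of "sqrt e"] that by (simp add: s_eq f hdiff_L2 hnorm_L2 sq_integrable_diff)
  from sq_integrable_complete[OF f this] obtain g where g: "g \<in> sq_integrable M"
    and lim: "(\<lambda>n. \<integral>x. (cmod (f n x - g x))\<^sup>2 \<partial>M) \<longlonglongrightarrow> 0"
    by blast
  have "(\<lambda>n. hnorm (L2 M) (hdiff (L2 M) (s n) (l2_class M g))) \<longlonglongrightarrow> 0"
    using tendsto_real_sqrt[OF lim] by (simp add: s_eq f g hdiff_L2 hnorm_L2 sq_integrable_diff)
  then show "\<exists>A\<in>hcarrier (L2 M). (\<lambda>n. hnorm (L2 M) (hdiff (L2 M) (s n) A)) \<longlonglongrightarrow> 0"
    using g by (auto simp: L2_carrier)
qed

section \<open>The weighted sequence space as a Hilbert space\<close>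

context
  fixes w :: "nat \<Rightarrow> real"
  assumes w_pos: "\<And>i. w i > 0"
begin

text \<open>Under this measure square summability with weights is square integrability, so the
  integral identities and Riesz-Fischer carry over. Positive weights leave only the empty null set,
  so sequences need no passage to classes.\<close>

definition weighted_count :: "nat measure" where
  "weighted_count = density (count_space UNIV) (\<lambda>i. ennreal (w i))"

lemma ell2_carrier: "hcarrier (ell2 w) = sq_integrable weighted_count"
  using w_pos
  by (auto simp: ell2_def sq_integrable_def weighted_count_def integrable_density
      integrable_count_space_nat_iff abs_mult less_imp_le)

lemma hinner_ell2:
  assumes "c \<in> sq_integrable weighted_count" "d \<in> sq_integrable weighted_count"
  shows "hinner (ell2 w) c d = (\<integral>i. cnj (c i) * d i \<partial>weighted_count)"
proof -
  have "integrable (count_space UNIV) (\<lambda>i. w i *\<^sub>R (cnj (c i) * d i))"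
    using integrable_cnj_mult[OF assms] w_pos
    by (simp add: weighted_count_def integrable_density less_imp_le)
  from integral_count_space_nat[OF this] show ?thesis
    using w_pos by (simp add: ell2_def weighted_count_def integral_density less_imp_le
        scaleR_conv_of_real mult.assoc)
qed

lemma ell2_ops [simp]:
  "hadd (ell2 w) c d = (\<lambda>i. c i + d i)"
  "hscale (ell2 w) a c = (\<lambda>i. a * c i)"
  "hdiff (ell2 w) c d = (\<lambda>i. c i - d i)"
  by (simp_all add: ell2_def hdiff_def)

lemma hilbert_space_ell2: "hilbert_space (ell2 w)"
proof
  show "hcarrier (ell2 w) \<noteq> {}"
    using sq_integrable_zero by (auto simp: ell2_carrier)
next
  fix c d assume "c \<in> hcarrier (ell2 w)" "d \<in> hcarrier (ell2 w)"
  then show "hadd (ell2 w) c d \<in> hcarrier (ell2 w)"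
    by (simp add: ell2_carrier sq_integrable_add)
next
  fix c a assume "c \<in> hcarrier (ell2 w)"
  then show "hscale (ell2 w) a c \<in> hcarrier (ell2 w)"
    by (simp add: ell2_carrier sq_integrable_scale)
next
  fix b c d assume "b \<in> hcarrier (ell2 w)" "c \<in> hcarrier (ell2 w)" "d \<in> hcarrier (ell2 w)"
  then show "hinner (ell2 w) b (hadd (ell2 w) c d) = hinner (ell2 w) b c + hinner (ell2 w) b d"
    by (simp add: ell2_carrier hinner_ell2 sq_integrable_add integral_cnj_mult_add)
next
  fix c d a assume "c \<in> hcarrier (ell2 w)" "d \<in> hcarrier (ell2 w)"
  then show "hinner (ell2 w) c (hscale (ell2 w) a d) = a * hinner (ell2 w) c d"
    by (simp add: ell2_carrier hinner_ell2 sq_integrable_scale integral_cnj_mult_scale)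
next
  fix c d assume "c \<in> hcarrier (ell2 w)" "d \<in> hcarrier (ell2 w)"
  then show "hinner (ell2 w) c d = cnj (hinner (ell2 w) d c)"
    by (simp only: ell2_carrier hinner_ell2 integral_cnj_mult_commute[of _ c d])
next
  fix c assume "c \<in> hcarrier (ell2 w)"
  then show "0 \<le> Re (hinner (ell2 w) c c)"
    by (simp add: ell2_carrier hinner_ell2 integral_cnj_mult_self)
next
  fix c d assume cd: "c \<in> hcarrier (ell2 w)" "d \<in> hcarrier (ell2 w)"
    and 0: "hinner (ell2 w) (hdiff (ell2 w) c d) (hdiff (ell2 w) c d) = 0"
  have sq: "(\<lambda>i. c i - d i) \<in> sq_integrable weighted_count"
    using cd by (simp add: ell2_carrier sq_integrable_diff)
  then have "(\<integral>i. (cmod (c i - d i))\<^sup>2 \<partial>weighted_count) = 0"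
    using 0 integral_cnj_mult_self[of weighted_count "\<lambda>i. c i - d i"] by (simp add: hinner_ell2)
  then have "AE i in weighted_count. (cmod (c i - d i))\<^sup>2 = 0"
    using sq_integrableD(2)[OF sq] by (simp add: integral_nonneg_eq_0_iff_AE)
  \<comment> \<open>Almost everywhere for this density means at every index of positive weight,
    hence everywhere.\<close>
  then have "\<forall>i. 0 < w i \<longrightarrow> (cmod (c i - d i))\<^sup>2 = 0"
    unfolding weighted_count_def by (subst (asm) AE_density) (simp_all add: AE_count_space)
  then show "c = d"
    using w_pos by auto
next
  fix s :: "nat \<Rightarrow> _"
  assume s: "\<And>n. s n \<in> hcarrier (ell2 w)"
    and Cauchy: "\<forall>e>0. \<exists>N. \<forall>m\<ge>N. \<forall>n\<ge>N. hnorm (ell2 w) (hdiff (ell2 w) (s m) (s n)) < e"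
  have norm_eq: "hnorm (ell2 w) c = sqrt (\<integral>i. (cmod (c i))\<^sup>2 \<partial>weighted_count)"
    if "c \<in> sq_integrable weighted_count" for c
    using that by (simp add: hnorm_def hinner_ell2 integral_cnj_mult_self)
  have s': "s n \<in> sq_integrable weighted_count" for n
    using s by (simp add: ell2_carrier)
  have "\<exists>N. \<forall>m\<ge>N. \<forall>n\<ge>N. (\<integral>i. (cmod (s m i - s n i))\<^sup>2 \<partial>weighted_count) < e" if "e > 0" for e
    using Cauchy[rule_format, of "sqrt e"] that by (simp add: s' norm_eq sq_integrable_diff)
  from sq_integrable_complete[OF s' this] obtain g where g: "g \<in> sq_integrable weighted_count"
    and lim: "(\<lambda>n. \<integral>i. (cmod (s n i - g i))\<^sup>2 \<partial>weighted_count) \<longlonglongrightarrow> 0"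
    by blast
  have "(\<lambda>n. hnorm (ell2 w) (hdiff (ell2 w) (s n) g)) \<longlonglongrightarrow> 0"
    using tendsto_real_sqrt[OF lim] by (simp add: s' g norm_eq sq_integrable_diff)
  then show "\<exists>c\<in>hcarrier (ell2 w). (\<lambda>n. hnorm (ell2 w) (hdiff (ell2 w) (s n) c)) \<longlonglongrightarrow> 0"
    using g by (auto simp: ell2_carrier)
qed

section \<open>The graph of the polynomial operator\<close>

lemma subspace_poly_op:
  assumes sets: "sets \<mu> = sets borel" and int: "\<And>j::nat. integrable \<mu> (\<lambda>x. x ^ j)"
  shows "hermitian_space.subspace (hprod (ell2 w) (L2 \<mu>)) (poly_op \<mu>)"
proof -
  interpret X: hilbert_space "ell2 w" by (rule hilbert_space_ell2)
  interpret Y: hilbert_space "L2 \<mu>" by (rule hilbert_space_L2)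
  interpret Z: hermitian_space "hprod (ell2 w) (L2 \<mu>)"
    by (rule hermitian_space_hprod) unfold_locales
  define P where "P c = (\<lambda>x::real. \<Sum>i\<in>{i. c i \<noteq> 0}. c i * of_real x ^ i)" for c :: "nat \<Rightarrow> complex"
  have op: "poly_op \<mu> = {(c, l2_class \<mu> (P c)) | c. finite {i. c i \<noteq> 0}}"
    by (simp add: poly_op_def P_def)
  \<comment> \<open>The defining sum runs over the support of \<open>c\<close>, which can shrink by
    cancellation when sequences are added or scaled by 0. Enlarging the index set makes the sums
    comparable term by term.\<close>
  have P_eq: "P c x = (\<Sum>i\<in>S. c i * of_real x ^ i)" if "finite S" "{i. c i \<noteq> 0} \<subseteq> S" for c S x
    unfolding P_def using that by (intro sum.mono_neutral_left) auto
  have "(\<lambda>x. of_real x ^ i) \<in> sq_integrable \<mu>" for i :: nat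
  proof -
    \<comment> \<open>The squared modulus of a monomial is an even power, so integrability of all
      powers puts every polynomial into \<open>sq_integrable\<close>.\<close>
    have "(cmod (of_real x ^ i))\<^sup>2 = x ^ (2 * i)" for x :: real
      by (simp add: norm_power power_mult power_even_abs flip: power_mult_distrib) (metis mult.commute power_even_abs power_mult power2_abs)
    moreover have "(\<lambda>x. of_real x ^ i :: complex) \<in> borel_measurable \<mu>"
      unfolding measurable_cong_sets[OF sets refl] by measurable
    ultimately show ?thesis
      using int[of "2 * i"] by (simp add: sq_integrable_def)
  qed
  then have P_sq: "P c \<in> sq_integrable \<mu>" for c
    unfolding P_def by (intro sq_integrable_sum sq_integrable_scale)
  have fin: "c \<in> hcarrier (ell2 w)" if "finite {i. c i \<noteq> 0}" for c
  proof -
    have "summable (\<lambda>i. w i * (cmod (c i))\<^sup>2)"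
      using that by (rule summable_finite) auto
    then show ?thesis
      by (simp add: ell2_def)
  qed
  have fin_add: "finite {i. c i + d i \<noteq> 0}" if "finite {i. c i \<noteq> 0}" "finite {i. d i \<noteq> 0}" for c d :: "nat \<Rightarrow> complex"
    using that by (auto intro!: finite_subset[of "{i. c i + d i \<noteq> 0}" "{i. c i \<noteq> 0} \<union> {i. d i \<noteq> 0}"])
  have P_add: "P (\<lambda>i. c i + d i) = (\<lambda>x. P c x + P d x)" if "finite {i. c i \<noteq> 0}" "finite {i. d i \<noteq> 0}" for c d
  proof
    fix x
    let ?S = "{i. c i \<noteq> 0} \<union> {i. d i \<noteq> 0}"
    have "finite ?S" "{i. c i + d i \<noteq> 0} \<subseteq> ?S"
      using that by auto
    then show "P (\<lambda>i. c i + d i) x = P c x + P d x"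
      using P_eq[of ?S c x] P_eq[of ?S d x] P_eq[of ?S "\<lambda>i. c i + d i" x]
      by (auto simp: distrib_right sum.distrib)
  qed
  have P_scale: "P (\<lambda>i. a * c i) = (\<lambda>x. a * P c x)" if "finite {i. c i \<noteq> 0}" for a c
    using P_eq[OF that, of "\<lambda>i. a * c i"] by (auto simp: P_def sum_distrib_left mult.assoc)
  show ?thesis
    unfolding Z.subspace_def
  proof (intro conjI ballI allI)
    have "(\<lambda>i. 0, l2_class \<mu> (P (\<lambda>i. 0))) \<in> poly_op \<mu>"
      by (auto simp: op)
    then show "poly_op \<mu> \<noteq> {}"
      by blast
    show "poly_op \<mu> \<subseteq> hcarrier (hprod (ell2 w) (L2 \<mu>))"
      using fin P_sq by (auto simp: op L2_carrier)
  next
    fix p q assume "p \<in> poly_op \<mu>" "q \<in> poly_op \<mu>"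
    then obtain c d where "finite {i. c i \<noteq> 0}" "finite {i. d i \<noteq> 0}"
      "p = (c, l2_class \<mu> (P c))" "q = (d, l2_class \<mu> (P d))"
      by (auto simp: op)
    then show "hadd (hprod (ell2 w) (L2 \<mu>)) p q \<in> poly_op \<mu>"
      using fin_add[of c d] by (auto simp: op hadd_L2 P_sq P_add intro!: exI[of _ "\<lambda>i. c i + d i"])
  next
    fix p a assume "p \<in> poly_op \<mu>"
    then obtain c where c: "finite {i. c i \<noteq> 0}" "p = (c, l2_class \<mu> (P c))"
      by (auto simp: op)
    have "finite {i. a * c i \<noteq> 0}"
      using c(1) by (rule finite_subset[rotated]) auto
    then show "hscale (hprod (ell2 w) (L2 \<mu>)) a p \<in> poly_op \<mu>"
      using c by (auto simp: op hscale_L2 P_sq P_scale)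
  qed
qed

end

theorem corollary6p5:
  fixes \<mu> :: "real measure" and w :: "nat \<Rightarrow> real"
    and F :: "((nat \<Rightarrow> complex) \<times> (real \<Rightarrow> complex) set) set"
    and Fw :: "((real \<Rightarrow> complex) set \<times> (nat \<Rightarrow> complex)) set"
    and H :: "((nat \<Rightarrow> complex) \<times> (nat \<Rightarrow> complex)) set"
    and K :: "((real \<Rightarrow> complex) set \<times> (real \<Rightarrow> complex) set) set"
  assumes "sets \<mu> = sets borel"
    and "measure_support \<mu> \<subseteq> {-1..1}"
    and "\<And>j::nat. integrable \<mu> (\<lambda>x. x ^ j)"
    and "\<And>i. w i > 0"
    and "\<And>k. summable (\<lambda>j. 1 / w j * \<bar>moment \<mu> (j + k)\<bar>\<^sup>2)"
    and "F = graph_closure (ell2 w) (L2 \<mu>) (poly_op \<mu>)"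
    and "Fw = hadjoint (ell2 w) (L2 \<mu>) F"
    and "H = F O Fw"
    and "K = Fw O F"
  shows "op_spectrum (ell2 w) H - {0} = op_spectrum (L2 \<mu>) K - {0}"
  unfolding assms(8,9)
  using hilbert_space_ell2[OF assms(4)] hilbert_space_L2 subspace_poly_op[OF assms(4,1,3)] assms(6,7)
  by (rule spectrum_adjoint_products)

end
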